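(* Let $m>1$ be an odd integer and let $H_m=\langle x,y \mid xyxy\cdots yx = yxyx\cdots xy\rangle$, where both words are alternating of length $m$ (the left one begins and ends with $x$, the right one begins and ends with $y$). Then the $SL(2,\mathbb{C})$ character variety of $H_m$ satisfies $$X(H_m)\cong\Big\{(X,Z)\in\mathbb{C}^2 \;\Big|\; (X^2-Z-2)\prod_{1\neq d\mid m}q_d^{*}(Z)=0\Big\},$$ the product being over the positive divisors $d\ne 1$ of $m$, and $\cong$ denoting isomorphism of affine algebraic sets.
   Context: Character variety. For a finitely presented group $G$, let $R(G)$ be the set of all homomorphisms $\rho:G\to SL(2,\mathbb{C})$, and for $g\in G$ let $\tau_g:R(G)\to\mathbb{C}$, $\tau_g(\rho)=\mathrm{tr}(\rho(g))$. Choose $\gamma_1,\dots,\gamma_\nu\in G$ such that $\tau_{\gamma_1},\dots,\tau_{\gamma_\nu}$ generate the ring generated by all the functions $\tau_g$, $g\in G$. The $SL(2,\mathbb{C})$ character variety of $G$ is $X(G)=\{(\tau_{\gamma_1}(\rho),\dots,\tau_{\gamma_\nu}(\rho)) \mid \rho\in R(G)\}\subseteq\mathbb{C}^\nu$; it is an affine algebraic set, well defined up to canonical isomorphism. For $G=H_m$ the functions $\tau_x,\tau_y,\tau_{xy}$ are generators; the coordinates in the claim are $X=\tau_x$ ($=\tau_y$) and $Z=\tau_{xy}$. Polynomials $q_d$. They are defined recursively by $q_1(T)=T-2$, $q_2(T)=T+2$ and, for $n\ge 3$, $$\prod_{1\neq d\mid n} q_d\left(X+\tfrac1X\right)=\frac{X^{n-1}+X^{n-2}+\dots+X+1}{X^{(n-1)/2}}\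 \text{ if $n$ is odd},\qquad \prod_{1,2\neq d\mid n} q_d\left(X+\tfrac1X\right)=\frac{X^{n-2}+X^{n-4}+\dots+X^2+1}{X^{(n-2)/2}}\ \text{ if $n$ is even}.$$ Star operation. For a polynomial $g(T)=\sum_{i=0}^n a_iT^i$ of degree $n$, $g^{*}(T)=\sum_{i=0}^n(-1)^{n-i}a_iT^i$, i.e. $g^*(T)=(-1)^{\deg g}g(-T)$. *)

theory Defs
  imports
    "HOL-Analysis.Analysis"
    "HOL-Algebra.Generated_Rings"
    "HOL-Computational_Algebra.Polynomial"
begin

section \<open>Groups given by generators and relations\<close>

text \<open>
  A letter \<open>(a, True)\<close> is the generator \<open>a\<close>, and \<open>(a, False)\<close> is its formal inverse; every
  element of the type \<open>'a\<close> is a generator.  A pair \<open>(r, s)\<close> in \<open>R\<close> is the relation \<open>r = s\<close>.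
\<close>

type_synonym 'a word = "('a \<times> bool) list"

inductive word_eq :: "('a word \<times> 'a word) set \<Rightarrow> 'a word \<Rightarrow> 'a word \<Rightarrow> bool" for R where
  refl: "word_eq R u u"
| sym: "word_eq R u v \<Longrightarrow> word_eq R v u"
| trans: "word_eq R u v \<Longrightarrow> word_eq R v w \<Longrightarrow> word_eq R u w"
| cancel: "word_eq R (u @ [(a, b), (a, \<not> b)] @ v) (u @ v)"
| rel: "(r, s) \<in> R \<Longrightarrow> word_eq R (u @ r @ v) (u @ s @ v)"

definition word_class :: "('a word \<times> 'a word) set \<Rightarrow> 'a word \<Rightarrow> 'a word set" where
  "word_class R u = {v. word_eq R u v}"

definition presented_group :: "('a word \<times> 'a word) set \<Rightarrow> 'a word set monoid" where
  "presented_group R =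
     \<lparr>carrier = range (word_class R),
      mult = (\<lambda>A B. {w. \<exists>u\<in>A. \<exists>v\<in>B. word_eq R (u @ v) w}),
      one = word_class R []\<rparr>"

lemma word_class_eq_iff: "word_class R u = word_class R v \<longleftrightarrow> word_eq R u v"
  unfolding word_class_def by (auto intro: word_eq.intros)

lemma word_eq_append_left: "word_eq R u v \<Longrightarrow> word_eq R (w @ u) (w @ v)"
proof (induction rule: word_eq.induct)
  case (cancel u a b v)
  show ?case using word_eq.cancel[of R "w @ u" a b v] by simp
next
  case (rel r s u v)
  then show ?case using word_eq.rel[of r s R "w @ u" v] by simp
qed (auto intro: word_eq.intros)

lemma word_eq_append_right: "word_eq R u v \<Longrightarrow> word_eq R (u @ w) (v @ w)"
proof (induction rule: word_eq.induct)
  case (cancel u a b v)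
  show ?case using word_eq.cancel[of R u a b "v @ w"] by simp
next
  case (rel r s u v)
  then show ?case using word_eq.rel[of r s R u "v @ w"] by simp
qed (auto intro: word_eq.intros)

lemma word_eq_append:
  "word_eq R u u' \<Longrightarrow> word_eq R v v' \<Longrightarrow> word_eq R (u @ v) (u' @ v')"
  by (meson word_eq.trans word_eq_append_left word_eq_append_right)

lemma presented_group_mult:
  "word_class R u \<otimes>\<^bsub>presented_group R\<^esub> word_class R v = word_class R (u @ v)"
  unfolding presented_group_def word_class_def
  by (auto intro: word_eq.intros word_eq_append)

lemma presented_group_one: "\<one>\<^bsub>presented_group R\<^esub> = word_class R []"
  by (simp add: presented_group_def)

lemma presented_group_carrier: "carrier (presented_group R) = range (word_class R)"
  by (simp add: presented_group_def)

lemma word_left_inverse: "\<exists>v. word_eq R (v @ u) []"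
proof (induction u)
  case Nil
  show ?case by (metis append_Nil word_eq.refl)
next
  case (Cons l u)
  then obtain v where v: "word_eq R (v @ u) []" by blast
  obtain a b where l: "l = (a, b)" by force
  have "word_eq R (v @ [(a, \<not> b), (a, b)] @ u) (v @ u)"
    using word_eq.cancel[of R v a "\<not> b" u] by simp
  then have "word_eq R ((v @ [(a, \<not> b)]) @ l # u) []"
    using v l by (auto intro: word_eq.trans)
  then show ?case by blast
qed

lemma group_presented_group: "group (presented_group R)"
proof (rule groupI)
  fix x assume "x \<in> carrier (presented_group R)"
  then obtain u where u: "x = word_class R u"
    by (auto simp: presented_group_carrier)
  obtain v where "word_eq R (v @ u) []"
    using word_left_inverse by blast
  then show "\<exists>y\<in>carrier (presented_group R). y \<otimes>\<^bsub>presented_group R\<^esub> x = \<one>\<^bsub>presented_group R\<^esub>"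
    using u
    by (auto simp: presented_group_carrier presented_group_mult presented_group_one
        word_class_eq_iff)
qed (auto simp: presented_group_carrier presented_group_mult presented_group_one)

section \<open>The groups \<open>H\<^sub>m\<close>\<close>

datatype gen = Gx | Gy

fun alternating :: "gen \<Rightarrow> gen \<Rightarrow> nat \<Rightarrow> gen word" where
  "alternating a b 0 = []"
| "alternating a b (Suc n) = (a, True) # alternating b a n"

definition H_rel :: "nat \<Rightarrow> (gen word \<times> gen word) set" where
  "H_rel m = {(alternating Gx Gy m, alternating Gy Gx m)}"

definition H :: "nat \<Rightarrow> gen word set monoid" where
  "H m = presented_group (H_rel m)"

definition H_x :: "nat \<Rightarrow> gen word set" where
  "H_x m = word_class (H_rel m) [(Gx, True)]"

definition H_y :: "nat \<Rightarrow> gen word set" where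
  "H_y m = word_class (H_rel m) [(Gy, True)]"

section \<open>Affine algebraic sets\<close>

text \<open>Points of \<open>\<complex>\<^sup>n\<close> are lists of length \<open>n\<close>, since the number of coordinates must vary.\<close>

inductive polynomial_fun :: "nat \<Rightarrow> (complex list \<Rightarrow> complex) \<Rightarrow> bool" for n where
  const: "polynomial_fun n (\<lambda>_. c)"
| coord: "i < n \<Longrightarrow> polynomial_fun n (\<lambda>v. v ! i)"
| add: "polynomial_fun n f \<Longrightarrow> polynomial_fun n g \<Longrightarrow> polynomial_fun n (\<lambda>v. f v + g v)"
| mult: "polynomial_fun n f \<Longrightarrow> polynomial_fun n g \<Longrightarrow> polynomial_fun n (\<lambda>v. f v * g v)"

definition affine_algebraic_set :: "nat \<Rightarrow> complex list set \<Rightarrow> bool" where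
  "affine_algebraic_set n S \<longleftrightarrow>
     (\<exists>F. finite F \<and> (\<forall>f\<in>F. polynomial_fun n f) \<and> S = {v. length v = n \<and> (\<forall>f\<in>F. f v = 0)})"

definition regular_map ::
  "nat \<Rightarrow> complex list set \<Rightarrow> nat \<Rightarrow> complex list set \<Rightarrow> (complex list \<Rightarrow> complex list) \<Rightarrow> bool" where
  "regular_map n S k T \<phi> \<longleftrightarrow>
     \<phi> \<in> S \<rightarrow> T \<and>
     (\<exists>fs. length fs = k \<and> (\<forall>f\<in>set fs. polynomial_fun n f) \<and> (\<forall>v\<in>S. \<phi> v = map (\<lambda>f. f v) fs))"

definition affine_iso ::
  "nat \<Rightarrow> complex list set \<Rightarrow> nat \<Rightarrow> complex list set \<Rightarrow> (complex list \<Rightarrow> complex list) \<Rightarrow> bool" where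
  "affine_iso n S k T \<phi> \<longleftrightarrow>
     affine_algebraic_set n S \<and> affine_algebraic_set k T \<and> regular_map n S k T \<phi> \<and>
     (\<exists>\<psi>. regular_map k T n S \<psi> \<and> (\<forall>v\<in>S. \<psi> (\<phi> v) = v) \<and> (\<forall>w\<in>T. \<phi> (\<psi> w) = w))"

section \<open>Character varieties\<close>

definition SL2C :: "(complex^2^2) monoid" where
  "SL2C = \<lparr>carrier = {A. det A = 1}, mult = (**), one = mat 1\<rparr>"

lemma group_SL2C: "group SL2C"
proof (rule groupI)
  fix A assume "A \<in> carrier SL2C"
  then have det: "det A = 1" by (simp add: SL2C_def)
  then have "invertible A" by (simp add: invertible_det_nz)
  then obtain B where B: "B ** A = mat 1" by (auto simp: invertible_def)
  then have "det B * det A = 1" by (metis det_I det_mul)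
  then show "\<exists>B\<in>carrier SL2C. B \<otimes>\<^bsub>SL2C\<^esub> A = \<one>\<^bsub>SL2C\<^esub>"
    using B det by (auto simp: SL2C_def)
qed (auto simp: SL2C_def det_mul matrix_mul_assoc)

text \<open>Homomorphisms are made extensional, so that distinct elements are distinct on the group.\<close>

definition reps :: "('g, 'b) monoid_scheme \<Rightarrow> ('g \<Rightarrow> complex^2^2) set" where
  "reps G = hom G SL2C \<inter> extensional (carrier G)"

definition function_ring :: "'s set \<Rightarrow> ('s \<Rightarrow> complex) ring" where
  "function_ring S =
     \<lparr>carrier = extensional S,
      mult = (\<lambda>f g. restrict (\<lambda>s. f s * g s) S), one = restrict (\<lambda>_. 1) S,
      zero = restrict (\<lambda>_. 0) S, add = (\<lambda>f g. restrict (\<lambda>s. f s + g s) S)\<rparr>"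

lemma cring_function_ring: "cring (function_ring S)"
proof (rule cringI)
  show "abelian_group (function_ring S)"
  proof (rule abelian_groupI)
    fix f assume "f \<in> carrier (function_ring S)"
    then show "\<exists>g\<in>carrier (function_ring S). g \<oplus>\<^bsub>function_ring S\<^esub> f = \<zero>\<^bsub>function_ring S\<^esub>"
      by (intro bexI[of _ "restrict (\<lambda>s. - f s) S"]) (auto simp: function_ring_def)
  qed (auto simp: function_ring_def restrict_def extensional_def fun_eq_iff)
  show "comm_monoid (function_ring S)"
    by (rule comm_monoidI) (auto simp: function_ring_def restrict_def extensional_def fun_eq_iff)
qed (auto simp: function_ring_def restrict_def fun_eq_iff algebra_simps)

definition tau :: "('g, 'b) monoid_scheme \<Rightarrow> 'g \<Rightarrow> ('g \<Rightarrow> complex^2^2) \<Rightarrow> complex" where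
  "tau G g = restrict (\<lambda>\<rho>. trace (\<rho> g)) (reps G)"

definition trace_generators :: "('g, 'b) monoid_scheme \<Rightarrow> 'g list \<Rightarrow> bool" where
  "trace_generators G \<gamma>s \<longleftrightarrow>
     set \<gamma>s \<subseteq> carrier G \<and>
     generate_ring (function_ring (reps G)) (tau G ` set \<gamma>s) =
     generate_ring (function_ring (reps G)) (tau G ` carrier G)"

definition trace_point ::
  "('g, 'b) monoid_scheme \<Rightarrow> 'g list \<Rightarrow> ('g \<Rightarrow> complex^2^2) \<Rightarrow> complex list" where
  "trace_point G \<gamma>s \<rho> = map (\<lambda>g. tau G g \<rho>) \<gamma>s"

text \<open>
  The character variety in the coordinates \<open>\<gamma>s\<close>; it depends on \<open>\<gamma>s\<close> only up to isomorphism as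
  long as \<open>trace_generators G \<gamma>s\<close> holds.
\<close>

definition character_variety :: "('g, 'b) monoid_scheme \<Rightarrow> 'g list \<Rightarrow> complex list set" where
  "character_variety G \<gamma>s = trace_point G \<gamma>s ` reps G"

section \<open>The polynomials \<open>q\<^sub>d\<close> and the star operation\<close>

text \<open>
  For \<open>n \<ge> 3\<close> the defining identity is solved for the factor \<open>d = n\<close>.  It is an identity of rational
  functions in \<open>x\<close>, stated for all nonzero complex numbers \<open>x\<close>.  At most one polynomial satisfies
  it, as the values \<open>x + 1/x\<close> exhaust \<open>\<complex>\<close> and the other factors are nonzero; the solution is the
  product of \<open>T - 2 cos (2 \<pi> k / n)\<close> over \<open>0 < k < n / 2\<close> with \<open>k\<close> coprime to \<open>n\<close>.
  The value at \<open>n = 0\<close> is a dummy.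
\<close>

function q_poly :: "nat \<Rightarrow> complex poly" where
  "q_poly n =
     (if n = 0 then 0
      else if n = 1 then [:-2, 1:]
      else if n = 2 then [:2, 1:]
      else if odd n then
        (THE p. \<forall>x. x \<noteq> 0 \<longrightarrow>
           (\<Prod>d\<in>{d. d dvd n \<and> d \<noteq> 1 \<and> d < n}. poly (q_poly d) (x + 1 / x)) * poly p (x + 1 / x)
             = (\<Sum>i<n. x ^ i) / x ^ ((n - 1) div 2))
      else
        (THE p. \<forall>x. x \<noteq> 0 \<longrightarrow>
           (\<Prod>d\<in>{d. d dvd n \<and> d \<noteq> 1 \<and> d \<noteq> 2 \<and> d < n}. poly (q_poly d) (x + 1 / x))
               * poly p (x + 1 / x)
             = (\<Sum>i<n div 2. x ^ (2 * i)) / x ^ ((n - 2) div 2)))"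
  by auto
termination by (relation "Wellfounded.measure id") auto

declare q_poly.simps [simp del]

definition star :: "'a::comm_ring_1 poly \<Rightarrow> 'a poly" where
  "star g = (\<Sum>i\<le>degree g. Polynomial.monom ((-1) ^ (degree g - i) * poly.coeff g i) i)"

definition H_curve :: "nat \<Rightarrow> complex list set" where
  "H_curve m =
     {[X, Z] | X Z. (X\<^sup>2 - Z - 2) * (\<Prod>d\<in>{d. d dvd m \<and> d \<noteq> 1}. poly (star (q_poly d)) Z) = 0}"

end

theory Submission
  imports Defs
begin

text \<open>
  Let \<open>m = 2 k + 1\<close> and let \<open>A\<close>, \<open>B\<close> be the images of \<open>x\<close>, \<open>y\<close>.  The relation
  \<open>(A B)\<^sup>k A = B (A B)\<^sup>k\<close> makes \<open>A\<close> and \<open>B\<close> conjugate, so they have the same trace \<open>X\<close>.  For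
  matrices of equal trace, Cayley--Hamilton gives \<open>(A B)\<^sup>k A - B (A B)\<^sup>k = f\<^sub>k(Z) (A - B)\<close> with
  \<open>Z = tr (A B)\<close>, \<open>f\<^sub>0 = 1\<close>, \<open>f\<^sub>1 = Z - 1\<close> and \<open>f\<^sub>k\<^sub>+\<^sub>2 = Z f\<^sub>k\<^sub>+\<^sub>1 - f\<^sub>k\<close> (\<open>curve_seq\<close>).
  Hence the relation means \<open>f\<^sub>k(Z) = 0\<close> or \<open>A = B\<close>, and in the latter case \<open>Z = X\<^sup>2 - 2\<close>.  With
  \<open>Z = - (w + 1/w)\<close> one has \<open>f\<^sub>k(Z) = (1 + w + \<dots> + w\<^sup>m\<^sup>-\<^sup>1) / (-w)\<^sup>k\<close>, which up to sign is the product
  of the \<open>q\<^sub>d(- Z)\<close> over the divisors \<open>d \<noteq> 1\<close> of \<open>m\<close>.  The \<open>q\<^sub>d\<close> are found by grouping the roots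
  of unity by their order and pairing each of them with its inverse.

  By Cayley--Hamilton again, every word in \<open>A\<^sup>\<plusminus>\<^sup>1\<close>, \<open>B\<^sup>\<plusminus>\<^sup>1\<close> is a combination of \<open>1\<close>, \<open>A\<close>,
  \<open>B\<close>, \<open>A B\<close> whose coefficients are integer polynomials in the three basic traces; taking traces shows
  that these generate the trace ring.  Two generating families are polynomials in each other, which
  yields the isomorphism for arbitrary coordinates.
\<close>

section \<open>Evaluating words in a group and in \<open>SL(2,\<complex>)\<close>\<close>

primrec word_eval :: "('g, 'b) monoid_scheme \<Rightarrow> ('a \<Rightarrow> 'g) \<Rightarrow> 'a word \<Rightarrow> 'g" where
  "word_eval G f [] = \<one>\<^bsub>G\<^esub>"
| "word_eval G f (l # w) = (if snd l then f (fst l) else inv\<^bsub>G\<^esub> f (fst l)) \<otimes>\<^bsub>G\<^esub> word_eval G f w"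

context group
begin

lemma word_eval_closed:
  assumes "\<And>a. f a \<in> carrier G"
  shows "word_eval G f w \<in> carrier G"
  using assms by (induction w) auto

lemma word_eval_append:
  assumes "\<And>a. f a \<in> carrier G"
  shows "word_eval G f (u @ v) = word_eval G f u \<otimes> word_eval G f v"
  using assms by (induction u) (auto simp: m_assoc word_eval_closed)

text \<open>Each rule generating \<open>word_eq\<close> preserves values: cancellation by the group
  laws, a relation by hypothesis.\<close>

lemma word_eval_word_eq:
  assumes f: "\<And>a. f a \<in> carrier G"
    and R: "\<And>r s. (r, s) \<in> R \<Longrightarrow> word_eval G f r = word_eval G f s"
    and "word_eq R u v"
  shows "word_eval G f u = word_eval G f v"
  using assms(3)
proof (induction rule: word_eq.induct)
  case (cancel u a b v)
  have "word_eval G f [(a, b), (a, \<not> b)] = \<one>"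
    using f by (cases b) auto
  then have "word_eval G f ([(a, b), (a, \<not> b)] @ v) = word_eval G f v"
    unfolding word_eval_append[of f, OF f] using f by (simp add: word_eval_closed)
  then show ?case
    by (metis f word_eval_append)
qed (auto simp: word_eval_append[of f, OF f] R)

text \<open>The cancellation rule makes the class of a formal inverse the inverse of the class of
  its generator, so the values on generators determine a homomorphism.\<close>

lemma hom_word_class:
  assumes \<rho>: "\<rho> \<in> hom (presented_group R) G"
  shows "\<rho> (word_class R u) = word_eval G (\<lambda>a. \<rho> (word_class R [(a, True)])) u"
proof (induction u)
  interpret P: group "presented_group R" by (rule group_presented_group)
  interpret group_hom "presented_group R" G \<rho>
    using \<rho> by unfold_locales
  {
    case Nil
    then show ?case
      using hom_one by (simp add: presented_group_one)
  next
    case (Cons l u)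
    obtain a b where l: "l = (a, b)" by force
    have c: "word_class R w \<in> carrier (presented_group R)" for w
      by (simp add: presented_group_carrier)
    have "word_class R [(a, False)] \<otimes>\<^bsub>presented_group R\<^esub> word_class R [(a, True)] = \<one>\<^bsub>presented_group R\<^esub>"
      using word_eq.cancel[of R "[]" a False "[]"]
      by (simp add: presented_group_mult presented_group_one word_class_eq_iff)
    then have "word_class R [(a, False)] = inv\<^bsub>presented_group R\<^esub> word_class R [(a, True)]"
      using c P.inv_equality by metis
    then have inv: "\<rho> (word_class R [(a, False)]) = inv \<rho> (word_class R [(a, True)])"
      using c by (simp add: hom_inv)
    have "\<rho> (word_class R (l # u)) = \<rho> (word_class R [l]) \<otimes> \<rho> (word_class R u)"
      using hom_mult[OF c c, of "[l]" u] by (simp add: presented_group_mult)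
    then show ?case
      using Cons inv l by (cases b) auto
  }
qed

text \<open>Von Dyck's theorem, with an extensional witness so that for \<open>SL2C\<close> it
  yields a member of \<open>reps\<close>.\<close>

lemma presented_group_hom_exists:
  assumes f: "\<And>a. f a \<in> carrier G"
    and R: "\<And>r s. (r, s) \<in> R \<Longrightarrow> word_eval G f r = word_eval G f s"
  obtains \<rho> where "\<rho> \<in> hom (presented_group R) G" "\<rho> \<in> extensional (carrier (presented_group R))"
    "\<And>u. \<rho> (word_class R u) = word_eval G f u"
proof -
  \<comment> \<open>One representative of each class is evaluated; by
    \<open>word_eval_word_eq\<close> the choice does not matter.\<close>
  define \<rho> where
    "\<rho> = restrict (\<lambda>c. word_eval G f (SOME u. word_class R u = c)) (carrier (presented_group R))"
  have \<rho>: "\<rho> (word_class R u) = word_eval G f u" for u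
  proof -
    have "word_class R (SOME v. word_class R v = word_class R u) = word_class R u"
      by (rule someI[of "\<lambda>v. word_class R v = word_class R u" u]) simp
    then have "word_eval G f (SOME v. word_class R v = word_class R u) = word_eval G f u"
      using word_eval_word_eq[of f R, OF f R] by (simp add: word_class_eq_iff)
    then show ?thesis
      by (simp add: \<rho>_def presented_group_carrier)
  qed
  show ?thesis
  proof (rule that)
    show "\<rho> \<in> hom (presented_group R) G"
      by (rule homI) (auto simp: presented_group_carrier presented_group_mult \<rho> f
          word_eval_closed word_eval_append)
  qed (simp_all add: \<rho>, simp add: \<rho>_def)
qed

end

section \<open>Calculus of 2 x 2 matrices of determinant 1\<close>

lemma mat2_eq_iff:
  "(A :: 'a^2^2) = B \<longleftrightarrow>
    A $ 1 $ 1 = B $ 1 $ 1 \<and> A $ 1 $ 2 = B $ 1 $ 2 \<and> A $ 2 $ 1 = B $ 2 $ 1 \<and> A $ 2 $ 2 = B $ 2 $ 2"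
  by (auto simp: vec_eq_iff forall_2)

lemma mat2_mult:
  fixes A B :: "'a::semiring_1^2^2"
  shows "(A ** B) $ i $ j = A $ i $ 1 * B $ 1 $ j + A $ i $ 2 * B $ 2 $ j"
  by (simp add: matrix_matrix_mult_def sum_2)

lemma mat2_trace: "trace (A :: 'a::semiring_1^2^2) = A $ 1 $ 1 + A $ 2 $ 2"
  by (simp add: trace_def sum_2)

lemma mat2_mat: "(mat c :: 'a::semiring_1^2^2) $ i $ j = (if i = j then c else 0)"
  by (simp add: mat_def)

lemmas mat2_simps = mat2_eq_iff mat2_mult mat2_trace mat2_mat det_2

text \<open>Naming the four entries turns a matrix identity into polynomial identities that Groebner
  bases can decide.\<close>

lemma mat2_cases:
  fixes A :: "'a::zero^2^2"
  obtains p q r s where "A = vector [vector [p, q], vector [r, s]]"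
proof (rule that)
  show "A = vector [vector [A $ 1 $ 1, A $ 1 $ 2], vector [A $ 2 $ 1, A $ 2 $ 2]]"
    by (simp add: mat2_eq_iff)
qed

text \<open>Cayley--Hamilton: A^2 - tr(A) A + 1 = 0, so the adjugate
  \<open>mat (trace A) - A\<close> is the inverse.\<close>

lemma SL2C_inv:
  assumes "det A = 1"
  shows "inv\<^bsub>SL2C\<^esub> A = mat (trace A) - A"
proof -
  interpret group SL2C by (rule group_SL2C)
  show ?thesis
    by (rule inv_equality) (use assms in \<open>auto simp: SL2C_def mat2_simps algebra_simps\<close>)
qed

text \<open>The normal form for values of words in A, B and their inverses. Scalars enter as
  \<open>mat a\<close>, so that only sums and matrix products occur.\<close>

definition comb :: "complex^2^2 \<Rightarrow> complex^2^2 \<Rightarrow> complex \<times> complex \<times> complex \<times> complex \<Rightarrow> complex^2^2"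
  where "comb A B p = (case p of (a, b, c, d) \<Rightarrow>
    mat a + mat b ** A + mat c ** B + mat d ** (A ** B))"

text \<open>Substitute A^2 = tr(A) A - 1 in the terms with coefficients b and d.\<close>

lemma comb_left1:
  assumes "det A = 1"
  shows "A ** comb A B (a, b, c, d) = comb A B (- b, a + trace A * b, - d, c + trace A * d)"
proof -
  obtain p q r s where A: "A = vector [vector [p, q], vector [r, s]]" by (rule mat2_cases)
  obtain t u v w where B: "B = vector [vector [t, u], vector [v, w]]" by (rule mat2_cases)
  show ?thesis
    using assms unfolding A B by (simp add: comb_def mat2_simps) (intro conjI; Groebner_Basis.algebra)
qed

text \<open>The coefficients come from B^2 = tr(B) B - 1, from the polarised identity B A = tr(A) B
  + tr(B) A + (tr(A B) - tr(A) tr(B)) - A B, and from B A B = tr(A B) B - tr(A) + A.\<close>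

lemma comb_left2:
  assumes "det A = 1" "det B = 1"
  shows "B ** comb A B (a, b, c, d) =
    comb A B (b * (trace (A ** B) - trace A * trace B) - c - d * trace A,
      b * trace B + d, a + b * trace A + c * trace B + d * trace (A ** B), - b)"
proof -
  obtain p q r s where A: "A = vector [vector [p, q], vector [r, s]]" by (rule mat2_cases)
  obtain t u v w where B: "B = vector [vector [t, u], vector [v, w]]" by (rule mat2_cases)
  show ?thesis
    using assms unfolding A B by (simp add: comb_def mat2_simps) (intro conjI; Groebner_Basis.algebra)
qed

text \<open>Meant for t = tr(C) and det C = 1, where \<open>mat t - C\<close> is the inverse of C:
  the rule for a generator gives the rule for its formal inverse.\<close>

lemma comb_scale_diff:
  assumes "M = comb A B (a, b, c, d)" "C ** M = comb A B (a', b', c', d')"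
  shows "(mat t - C) ** M = comb A B (t * a - a', t * b - b', t * c - c', t * d - d')"
proof -
  have "(mat t - C) ** M = mat t ** M - C ** M"
    by (simp add: mat2_simps algebra_simps)
  then show ?thesis
    unfolding assms(2) unfolding assms(1) by (simp add: comb_def mat2_simps algebra_simps)
qed

section \<open>The polynomials \<open>q\<^sub>d\<close> of odd index\<close>

lemma ex_add_inverse:
  fixes z :: complex
  obtains x where "x \<noteq> 0" "x + 1 / x = z"
proof -
  \<comment> \<open>A root of T^2 - z T + 1, nonzero because the constant term is 1.\<close>
  define x where "x = (z + csqrt (z\<^sup>2 - 4)) / 2"
  have sq: "x * x + 1 = z * x"
  proof -
    have "csqrt (z\<^sup>2 - 4) ^ 2 = z\<^sup>2 - 4" by simp
    then show ?thesis unfolding x_def by (simp add: field_simps power2_eq_square) Groebner_Basis.algebra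
  qed
  then have "x \<noteq> 0" by auto
  moreover from this sq have "x + 1 / x = z" by (simp add: field_simps)
  ultimately show ?thesis using that by blast
qed

lemma add_inverse_eq_iff:
  fixes x y :: "'a::field"
  assumes "x \<noteq> 0" "y \<noteq> 0"
  shows "x + 1 / x = y + 1 / y \<longleftrightarrow> x = y \<or> x = 1 / y"
proof -
  have "x + 1 / x - (y + 1 / y) = (x - y) * (x - 1 / y) / x"
    using assms by (simp add: field_simps)
  then show ?thesis
    using assms by (metis divide_eq_0_iff eq_iff_diff_eq_0 mult_eq_0_iff)
qed

text \<open>The values x + 1/x exhaust the complex numbers.\<close>

lemma poly_eqI_add_inverse:
  fixes p q :: "complex poly"
  assumes "\<And>x. x \<noteq> 0 \<Longrightarrow> poly p (x + 1 / x) = poly q (x + 1 / x)"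
  shows "p = q"
proof -
  have "poly p z = poly q z" for z
    using assms ex_add_inverse[of z] by metis
  then show ?thesis by (simp add: poly_eq_poly_eq_iff[symmetric] fun_eq_iff)
qed

section \<open>Roots of unity grouped by their order\<close>

lemma power_minus_one_eq_prod_roots_unity:
  fixes x :: complex
  assumes "n > 0"
  shows "x ^ n - 1 = (\<Prod>\<zeta>\<in>{\<zeta>. \<zeta> ^ n = 1}. x - \<zeta>)"
proof -
  let ?S = "{\<zeta>::complex. \<zeta> ^ n = 1}"
  define p where "p = Polynomial.monom 1 n - (1 :: complex poly)"
  define q where "q = (\<Prod>\<zeta>\<in>?S. [:- \<zeta>, 1:])"
  have card: "card ?S = n" using assms card_roots_unity_eq[of n] by simp
  have deg_q: "degree q = n"
    unfolding q_def by (subst degree_prod_eq_sum_degree) (auto simp: card)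
  have lc_q: "poly.coeff q n = 1"
    using lead_coeff_prod[of "\<lambda>\<zeta>. [:- \<zeta>, 1:]" ?S] deg_q by (simp add: q_def)
  \<comment> \<open>Both are monic of degree n, so a nonzero difference would have degree below n
    and yet vanish at all n roots of unity.\<close>
  have "p = q"
  proof (rule ccontr)
    assume "p \<noteq> q"
    then have nz: "p - q \<noteq> 0" by simp
    have "degree p \<le> n" unfolding p_def
      by (rule degree_diff_le) (auto simp: degree_monom_le)
    then have "degree (p - q) \<le> n" using deg_q by (intro degree_diff_le) auto
    moreover have "poly.coeff (p - q) n = 0" using assms lc_q by (simp add: p_def)
    ultimately have "degree (p - q) < n"
      using nz by (metis le_neq_implies_less leading_coeff_0_iff)
    moreover have "?S \<subseteq> {x. poly (p - q) x = 0}"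
      by (auto simp: p_def q_def poly_monom poly_prod finite_roots_unity[of n] assms Suc_leI)
    then have "n \<le> card {x. poly (p - q) x = 0}"
      using card_mono[OF poly_roots_finite[OF nz]] card by metis
    then have "n \<le> degree (p - q)"
      using card_poly_roots_bound[OF nz] by linarith
    ultimately show False by simp
  qed
  then have "poly p x = poly q x" by simp
  then show ?thesis by (simp add: p_def q_def poly_monom poly_prod)
qed

lemma sum_powers_eq_prod_roots_unity:
  fixes x :: complex
  assumes "n > 0"
  shows "(\<Sum>i<n. x ^ i) = (\<Prod>\<zeta>\<in>{\<zeta>. \<zeta> ^ n = 1} - {1}. x - \<zeta>)"
proof -
  let ?S = "{\<zeta>::complex. \<zeta> ^ n = 1}"
  have fin: "finite ?S" using assms finite_roots_unity[of n] by simp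
  \<comment> \<open>The factor T - 1 is cancelled in the polynomial ring, so that the identity also
    covers x = 1.\<close>
  have "[:-1, 1:] * (\<Sum>i<n. Polynomial.monom (1::complex) i) = [:-1, 1:] * (\<Prod>\<zeta>\<in>?S - {1}. [:- \<zeta>, 1:])"
  proof (rule poly_eqI_add_inverse)
    fix y :: complex
    define t where "t = y + 1 / y"
    have "t ^ n - 1 = (t - 1) * (\<Prod>\<zeta>\<in>?S - {1}. t - \<zeta>)"
      using power_minus_one_eq_prod_roots_unity[OF assms, of t] prod.remove[OF fin, of 1 "\<lambda>\<zeta>. t - \<zeta>"]
      by simp
    moreover have "t ^ n - 1 = (t - 1) * (\<Sum>i<n. t ^ i)" by (rule power_diff_1_eq)
    ultimately show "poly ([:-1, 1:] * (\<Sum>i<n. Polynomial.monom (1::complex) i)) (y + 1 / y)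
        = poly ([:-1, 1:] * (\<Prod>\<zeta>\<in>?S - {1}. [:- \<zeta>, 1:])) (y + 1 / y)"
      unfolding t_def[symmetric] by (simp add: poly_sum poly_monom poly_prod algebra_simps)
  qed
  then have "(\<Sum>i<n. Polynomial.monom (1::complex) i) = (\<Prod>\<zeta>\<in>?S - {1}. [:- \<zeta>, 1:])"
    by (subst (asm) mult_cancel_left) simp
  then have "poly (\<Sum>i<n. Polynomial.monom (1::complex) i) x = poly (\<Prod>\<zeta>\<in>?S - {1}. [:- \<zeta>, 1:]) x"
    by simp
  then show ?thesis by (simp add: poly_sum poly_monom poly_prod)
qed

text \<open>The complex numbers of multiplicative order exactly n; empty for n = 0.\<close>

definition primitive_roots :: "nat \<Rightarrow> complex set" where
  "primitive_roots n = {\<zeta>. n > 0 \<and> \<zeta> ^ n = 1 \<and> (\<forall>d. 0 < d \<and> d < n \<longrightarrow> \<zeta> ^ d \<noteq> 1)}"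

lemma primitive_roots_unique:
  assumes "\<zeta> \<in> primitive_roots n" "\<zeta> \<in> primitive_roots d"
  shows "n = d"
  using assms unfolding primitive_roots_def by (metis (mono_tags, lifting) linorder_neqE_nat mem_Collect_eq)

lemma primitive_roots_1: "primitive_roots 1 = {1}"
  by (auto simp: primitive_roots_def)

lemma inverse_mem_primitive_roots: "\<zeta> \<in> primitive_roots n \<Longrightarrow> 1 / \<zeta> \<in> primitive_roots n"
  by (auto simp: primitive_roots_def power_one_over)

lemma primitive_roots_nonzero: "\<zeta> \<in> primitive_roots n \<Longrightarrow> \<zeta> \<noteq> 0"
  by (auto simp: primitive_roots_def power_0_left)

lemma roots_unity_eq_UN_primitive_roots:
  assumes "n > 0"
  shows "{\<zeta>. \<zeta> ^ n = 1} = (\<Union>d\<in>{d. d dvd n}. primitive_roots d)"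
proof (intro equalityI subsetI)
  fix \<zeta> :: complex assume "\<zeta> \<in> {\<zeta>. \<zeta> ^ n = 1}"
  then have z: "\<zeta> ^ n = 1" by simp
  \<comment> \<open>The order of the root; its minimality forces n mod d = 0.\<close>
  define d where "d = (LEAST d. 0 < d \<and> \<zeta> ^ d = 1)"
  have d: "0 < d" "\<zeta> ^ d = 1"
    using LeastI[of "\<lambda>d. 0 < d \<and> \<zeta> ^ d = 1" n] z assms by (auto simp: d_def)
  have least: "d \<le> e" if "0 < e" "\<zeta> ^ e = 1" for e
    unfolding d_def by (rule Least_le) (use that in simp)
  have "\<zeta> ^ (n mod d) = 1"
    using z d(2) by (metis div_mult_mod_eq mult.commute mult_1 power_add power_mult power_one)
  then have "n mod d = 0"
    using least[of "n mod d"] d(1) by (metis mod_less_divisor not_gr_zero not_less)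
  moreover have "\<zeta> ^ e \<noteq> 1" if "0 < e \<and> e < d" for e
    using least[of e] that by auto
  then have "\<zeta> \<in> primitive_roots d"
    using d unfolding primitive_roots_def by simp
  ultimately show "\<zeta> \<in> (\<Union>d\<in>{d. d dvd n}. primitive_roots d)" by auto
qed (auto simp: primitive_roots_def power_mult)

text \<open>For n > 0 these are the numbers 2 cos(2 pi k / n) with k coprime to n; a root of unity
  and its inverse give the same element.\<close>

definition q_roots :: "nat \<Rightarrow> complex set" where
  "q_roots n = (\<lambda>\<zeta>. \<zeta> + 1 / \<zeta>) ` primitive_roots n"

lemma finite_primitive_roots: "finite (primitive_roots n)"
proof (cases "n = 0")
  case False
  then have "finite {\<zeta>::complex. \<zeta> ^ n = 1}" by (intro finite_roots_unity) auto
  then show ?thesis by (rule rev_finite_subset) (auto simp: primitive_roots_def)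
qed (simp add: primitive_roots_def)

lemma finite_q_roots: "finite (q_roots n)"
  by (simp add: q_roots_def finite_primitive_roots)

text \<open>The value x + 1/x determines x up to inversion, and inversion preserves the order of a
  root of unity.\<close>

lemma q_roots_disjoint:
  assumes "n \<noteq> d"
  shows "q_roots n \<inter> q_roots d = {}"
proof -
  have False if "\<zeta> \<in> primitive_roots n" "\<xi> \<in> primitive_roots d" "\<zeta> + 1 / \<zeta> = \<xi> + 1 / \<xi>" for \<zeta> \<xi>
    using that assms add_inverse_eq_iff[of \<zeta> \<xi>] primitive_roots_nonzero inverse_mem_primitive_roots
      primitive_roots_unique by metis
  then show ?thesis by (auto simp: q_roots_def)
qed

text \<open>For odd n the n-th roots of unity other than 1 form pairs {xi, 1/xi}, and (x - xi)(x -
  1/xi) = x (x + 1/x - a) with a = xi + 1/xi. The (n - 1)/2 factors x account for the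
  denominator.\<close>

lemma prod_q_roots:
  fixes x :: complex
  assumes n: "odd n" and x: "x \<noteq> 0"
  shows "(\<Prod>d\<in>{d. d dvd n \<and> d \<noteq> 1}. \<Prod>a\<in>q_roots d. x + 1 / x - a)
    = (\<Sum>i<n. x ^ i) / x ^ ((n - 1) div 2)"
proof -
  let ?S = "{\<zeta>::complex. \<zeta> ^ n = 1} - {1}"
  let ?D = "{d. d dvd n \<and> d \<noteq> 1}"
  let ?g = "\<lambda>\<zeta>::complex. \<zeta> + 1 / \<zeta>"
  have n0: "n > 0" using n by (cases n) auto
  have finD: "finite ?D" using n0 by (auto intro: finite_subset[OF _ finite_divisors_nat[of n]])
  have finS: "finite ?S" using n0 finite_roots_unity[of n] by simp
  have S: "?S = (\<Union>d\<in>?D. primitive_roots d)"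
  proof -
    have "1 \<notin> primitive_roots d" if "d \<noteq> 1" for d
      using that primitive_roots_unique[of 1 d 1] by (auto simp: primitive_roots_1[simplified])
    then show ?thesis
      unfolding roots_unity_eq_UN_primitive_roots[OF n0] using primitive_roots_1 by auto
  qed
  have img: "?g ` ?S = (\<Union>d\<in>?D. q_roots d)" by (simp add: S image_UN q_roots_def)
  have fibre: "{\<zeta> \<in> ?S. ?g \<zeta> = a} = {\<xi>, 1 / \<xi>} \<and> \<xi> \<noteq> 1 / \<xi> \<and> \<xi> \<noteq> 0" if "\<xi> \<in> ?S" "a = ?g \<xi>" for a \<xi>
  proof -
    have nz: "\<zeta> \<noteq> 0" if "\<zeta> \<in> ?S" for \<zeta> using that n0 by (auto simp: power_0_left)
    \<comment> \<open>A root equal to its inverse has square 1, so xi^n = xi as n is odd; then xi =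
      1, which is excluded.\<close>
    have "\<xi> \<noteq> 1 / \<xi>"
    proof
      assume "\<xi> = 1 / \<xi>"
      then have sq: "\<xi> ^ 2 = 1" using nz[OF that(1)] by (simp add: field_simps power2_eq_square)
      obtain k where k: "n = 2 * k + 1" using n by (elim oddE)
      have "\<xi> ^ n = \<xi>" using sq unfolding k by (simp add: power_mult)
      then show False using that(1) by simp
    qed
    moreover have "1 / \<xi> \<in> ?S" using that(1) nz by (auto simp: power_one_over)
    moreover have "?g \<zeta> = a \<longleftrightarrow> \<zeta> = \<xi> \<or> \<zeta> = 1 / \<xi>" if "\<zeta> \<in> ?S" for \<zeta>
      using add_inverse_eq_iff nz \<open>\<xi> \<in> ?S\<close> \<open>a = ?g \<xi>\<close> that by metis
    then have "{\<zeta> \<in> ?S. ?g \<zeta> = a} = ?S \<inter> {\<xi>, 1 / \<xi>}" by blast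
    moreover have "?S \<inter> {\<xi>, 1 / \<xi>} = {\<xi>, 1 / \<xi>}"
      using \<open>\<xi> \<in> ?S\<close> \<open>1 / \<xi> \<in> ?S\<close> by (intro Int_absorb1) simp
    ultimately show ?thesis using nz[OF \<open>\<xi> \<in> ?S\<close>] by (intro conjI) simp_all
  qed
  have pair: "(\<Prod>\<zeta>\<in>{\<zeta> \<in> ?S. ?g \<zeta> = a}. x - \<zeta>) = x * (x + 1 / x - a)
      \<and> card {\<zeta> \<in> ?S. ?g \<zeta> = a} = 2" if a: "a \<in> ?g ` ?S" for a
  proof -
    obtain \<xi> where \<xi>: "\<xi> \<in> ?S" "a = ?g \<xi>" using a by blast
    have f: "{\<zeta> \<in> ?S. ?g \<zeta> = a} = {\<xi>, 1 / \<xi>}" "\<xi> \<noteq> 1 / \<xi>" "\<xi> \<noteq> 0"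
      using fibre[OF \<xi>] by blast+
    show ?thesis unfolding f(1) unfolding \<xi>(2) using f(2,3) x by (simp add: field_simps)
  qed
  \<comment> \<open>Every fibre has two elements, which gives the number of values a and hence the
    exponent of x.\<close>
  have "card ?S = (\<Sum>a\<in>?g ` ?S. card {\<zeta> \<in> ?S. ?g \<zeta> = a})"
    unfolding card_eq_sum
    by (rule sum.group[OF finS finite_imageI[OF finS, of ?g] subset_refl, symmetric])
  also have "\<dots> = 2 * card (?g ` ?S)" using pair by simp
  finally have "card ?S = 2 * card (?g ` ?S)" .
  moreover have "card ?S = n - 1" using n0 card_roots_unity_eq[of n] by (simp add: card_Diff_subset)
  ultimately have card: "card (?g ` ?S) = (n - 1) div 2" by simp
  have "(\<Sum>i<n. x ^ i) = (\<Prod>\<zeta>\<in>?S. x - \<zeta>)" using sum_powers_eq_prod_roots_unity n0 by simp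
  also have "\<dots> = (\<Prod>a\<in>?g ` ?S. \<Prod>\<zeta>\<in>{\<zeta> \<in> ?S. ?g \<zeta> = a}. x - \<zeta>)"
    by (rule prod.group[OF finS finite_imageI[OF finS, of ?g] subset_refl, symmetric])
  also have "\<dots> = (\<Prod>a\<in>?g ` ?S. x * (x + 1 / x - a))" using pair by (intro prod.cong) auto
  also have "\<dots> = x ^ ((n - 1) div 2) * (\<Prod>a\<in>?g ` ?S. x + 1 / x - a)"
    by (simp add: prod.distrib card)
  also have "(\<Prod>a\<in>?g ` ?S. x + 1 / x - a) = (\<Prod>d\<in>?D. \<Prod>a\<in>q_roots d. x + 1 / x - a)"
    unfolding img using finD finite_q_roots q_roots_disjoint
    by (intro prod.UNION_disjoint) auto
  finally show ?thesis using x by (simp add: field_simps)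
qed

text \<open>Strong induction: the factors of the proper divisors are known, and
  \<open>prod_q_roots\<close> identifies the one missing factor.\<close>

lemma q_poly_odd:
  assumes "odd n" "n > 1"
  shows "q_poly n = (\<Prod>a\<in>q_roots n. [:- a, 1:])"
  using assms
proof (induction n rule: less_induct)
  case (less n)
  let ?D = "{d. d dvd n \<and> d \<noteq> 1 \<and> d < n}"
  let ?c = "\<lambda>n. \<Prod>a\<in>q_roots n. [:- a, 1:]"
  have finD: "finite ?D" by (rule finite_subset[of _ "{..<n}"]) auto
  have IH: "q_poly d = ?c d" if "d \<in> ?D" for d
  proof (rule less.IH)
    show "odd d" using that less.prems(1) by auto
    show "d > 1" using that less.prems by (auto intro!: Suc_lessI gr0I)
  qed (use that in auto)
  define Q where "Q = (\<Prod>d\<in>?D. ?c d)"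
  have Q: "(\<Prod>d\<in>?D. poly (q_poly d) t) = poly Q t" for t
    using IH by (simp add: Q_def poly_prod)
  have Q0: "Q \<noteq> 0" using finD finite_q_roots by (auto simp: Q_def)
  have ins: "{d. d dvd n \<and> d \<noteq> 1} = insert n ?D" using less.prems by (auto dest: dvd_imp_le)
  have ident: "poly Q (x + 1 / x) * poly (?c n) (x + 1 / x) = (\<Sum>i<n. x ^ i) / x ^ ((n - 1) div 2)"
    if "x \<noteq> 0" for x
    using prod_q_roots[OF less.prems(1) that] finD unfolding ins
    by (simp add: Q_def poly_prod mult.commute)
  have "n \<noteq> 0" "n \<noteq> 1" "n \<noteq> 2" using less.prems by auto
  then have "q_poly n = (THE p. \<forall>x. x \<noteq> 0 \<longrightarrow> poly Q (x + 1 / x) * poly p (x + 1 / x)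
             = (\<Sum>i<n. x ^ i) / x ^ ((n - 1) div 2))"
    using less.prems(1) unfolding Q[symmetric] by (subst q_poly.simps) simp
  also have "\<dots> = ?c n"
  proof (rule the_equality)
    fix p assume p: "\<forall>x. x \<noteq> 0 \<longrightarrow> poly Q (x + 1 / x) * poly p (x + 1 / x)
             = (\<Sum>i<n. x ^ i) / x ^ ((n - 1) div 2)"
    \<comment> \<open>Uniqueness for the definite description: the identity determines Q p, and Q is
      not zero.\<close>
    have "Q * p = Q * ?c n"
      by (rule poly_eqI_add_inverse) (use p ident in \<open>simp add: mult.commute\<close>)
    then show "p = ?c n" using Q0 by simp
  qed (use ident in simp)
  finally show ?case .
qed

section \<open>The star operation and the sequence of polynomials in the trace of A B\<close>

lemma poly_star:
  fixes g :: "'a::comm_ring_1 poly"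
  shows "poly (star g) z = (-1) ^ degree g * poly g (- z)"
proof -
  have "(-1 :: 'a) ^ (degree g - i) = (-1) ^ degree g * (-1) ^ i" if "i \<le> degree g" for i
  proof -
    have "(-1 :: 'a) ^ degree g * (-1) ^ i = (-1) ^ (degree g - i) * ((-1) ^ i * (-1) ^ i)"
      using that unfolding mult.assoc[symmetric] power_add[symmetric] by simp
    then show ?thesis unfolding power_mult_distrib[symmetric] by simp
  qed
  then show ?thesis
    unfolding star_def poly_altdef[of g] poly_sum poly_monom sum_distrib_left
    by (intro sum.cong) (auto simp: power_minus[of z] mult_ac)
qed

text \<open>A Chebyshev-type sequence: for z = 2 cos t with cos(t/2) nonzero, its value at k is
  cos((k + 1/2) t) / cos(t/2).\<close>

fun curve_seq :: "complex \<Rightarrow> nat \<Rightarrow> complex" where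
  "curve_seq z 0 = 1"
| "curve_seq z (Suc 0) = z - 1"
| "curve_seq z (Suc (Suc k)) = z * curve_seq z (Suc k) - curve_seq z k"

lemma curve_seq_eq_sum:
  assumes "w \<noteq> 0" "w + 1 / w = - z"
  shows "curve_seq z k * (- w) ^ k = (\<Sum>i<2 * k + 1. w ^ i)"
  using assms
proof (induction z k rule: curve_seq.induct)
  case (3 z k)
  have z: "z * w = - (w ^ 2) - 1"
    using "3.prems" by (simp add: field_simps power2_eq_square) Groebner_Basis.algebra
  have S: "(\<Sum>i<2 * Suc k + 1. w ^ i) = (\<Sum>i<2 * k + 1. w ^ i) + w ^ (2 * k + 1) + w ^ (2 * k + 2)" for k
    by simp
  \<comment> \<open>Multiplied by (-w)^(k + 2), the recursion has the coefficient -z w = w^2 + 1 in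
    place of z.\<close>
  have "curve_seq z (Suc (Suc k)) * (- w) ^ Suc (Suc k)
      = - (z * w) * (curve_seq z (Suc k) * (- w) ^ Suc k) - w ^ 2 * (curve_seq z k * (- w) ^ k)"
    by (simp add: algebra_simps power2_eq_square)
  also have "\<dots> = (w ^ 2 + 1) * (\<Sum>i<2 * Suc k + 1. w ^ i) - w ^ 2 * (\<Sum>i<2 * k + 1. w ^ i)"
    using "3.IH" "3.prems" unfolding z by simp
  also have "\<dots> = (\<Sum>i<2 * Suc (Suc k) + 1. w ^ i)"
    unfolding S by (simp add: algebra_simps power2_eq_square)
  finally show ?case .
next
  case (2 z)
  have "1 + w * w = - (w * z)" using 2 by (simp add: field_simps)
  then show ?case by (simp add: eval_nat_numeral algebra_simps) Groebner_Basis.algebra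
qed simp

text \<open>With -z = w + 1/w, the star evaluates each \<open>q_poly d\<close> at w + 1/w up to a
  sign, which does not affect vanishing. Both sides then reduce to the same geometric sum.\<close>

lemma prod_star_q_poly_eq_0_iff:
  assumes "m = 2 * k + 1"
  shows "(\<Prod>d\<in>{d. d dvd m \<and> d \<noteq> 1}. poly (star (q_poly d)) z) = 0 \<longleftrightarrow> curve_seq z k = 0"
proof -
  let ?D = "{d. d dvd m \<and> d \<noteq> 1}"
  have finD: "finite ?D" using assms by (auto intro: finite_subset[OF _ finite_divisors_nat[of m]])
  obtain w where w: "w \<noteq> 0" "w + 1 / w = - z" using ex_add_inverse by metis
  have D: "odd d \<and> d > 1" if "d \<in> ?D" for d
  proof
    have "d dvd m" "d \<noteq> 1" "odd m" using that assms by auto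
    then show "odd d" by (meson dvd_trans)
    then show "d > 1" using \<open>d \<noteq> 1\<close> by (auto intro!: Suc_lessI gr0I)
  qed
  have "(\<Prod>d\<in>?D. poly (star (q_poly d)) z) = 0 \<longleftrightarrow> (\<Prod>d\<in>?D. poly (q_poly d) (w + 1 / w)) = 0"
    using finD by (simp add: poly_star w)
  also have "(\<Prod>d\<in>?D. poly (q_poly d) (w + 1 / w)) = (\<Sum>i<m. w ^ i) / w ^ k"
  proof -
    have "(\<Prod>d\<in>?D. poly (q_poly d) (w + 1 / w)) = (\<Prod>d\<in>?D. \<Prod>a\<in>q_roots d. w + 1 / w - a)"
      by (intro prod.cong) (use D in \<open>auto simp: q_poly_odd poly_prod\<close>)
    then show ?thesis using prod_q_roots[of m w] assms w(1) by simp
  qed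
  also have "\<dots> = 0 \<longleftrightarrow> curve_seq z k = 0"
    using curve_seq_eq_sum[OF w, of k, symmetric] w(1) unfolding assms by simp
  finally show ?thesis .
qed

section \<open>Trace functions of two-generator groups\<close>

text \<open>Restricting inside the definition lets ordinary pointwise expressions stand for elements
  of the function ring, whose carrier is extensional.\<close>

definition in_gen :: "'s set \<Rightarrow> ('s \<Rightarrow> complex) set \<Rightarrow> ('s \<Rightarrow> complex) \<Rightarrow> bool" where
  "in_gen S K f \<longleftrightarrow> restrict f S \<in> generate_ring (function_ring S) K"

lemma a_inv_function_ring:
  assumes "f \<in> extensional S"
  shows "\<ominus>\<^bsub>function_ring S\<^esub> f = restrict (\<lambda>s. - f s) S"
proof -
  interpret cring "function_ring S" by (rule cring_function_ring)
  show ?thesis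
    by (rule minus_equality) (use assms in \<open>auto simp: function_ring_def\<close>)
qed

lemma in_gen_const: "in_gen S K (\<lambda>_. 1)"
  using generate_ring.one[of "function_ring S" K] by (simp add: in_gen_def function_ring_def)

lemma in_gen_uminus: "in_gen S K f \<Longrightarrow> in_gen S K (\<lambda>s. - f s)"
  using generate_ring.a_inv[of "restrict f S" "function_ring S" K]
  by (simp add: in_gen_def a_inv_function_ring cong: restrict_cong)

lemma in_gen_add: "in_gen S K f \<Longrightarrow> in_gen S K g \<Longrightarrow> in_gen S K (\<lambda>s. f s + g s)"
  using generate_ring.eng_add[of "restrict f S" "function_ring S" K "restrict g S"]
  by (simp add: in_gen_def function_ring_def cong: restrict_cong)

lemma in_gen_mult: "in_gen S K f \<Longrightarrow> in_gen S K g \<Longrightarrow> in_gen S K (\<lambda>s. f s * g s)"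
  using generate_ring.eng_mult[of "restrict f S" "function_ring S" K "restrict g S"]
  by (simp add: in_gen_def function_ring_def cong: restrict_cong)

lemma in_gen_diff: "in_gen S K f \<Longrightarrow> in_gen S K g \<Longrightarrow> in_gen S K (\<lambda>s. f s - g s)"
  using in_gen_add[of S K f "\<lambda>s. - g s"] in_gen_uminus[of S K g] by simp

lemma in_gen_zero: "in_gen S K (\<lambda>_. 0)"
  using in_gen_diff[OF in_gen_const in_gen_const] by simp

lemmas in_gen_intros = in_gen_const in_gen_zero in_gen_uminus in_gen_add in_gen_diff in_gen_mult

lemma tau_eq: "\<rho> \<in> reps G \<Longrightarrow> tau G g \<rho> = trace (\<rho> g)"
  by (simp add: tau_def)

lemma tau_extensional: "tau G g \<in> extensional (reps G)"
  by (simp add: tau_def)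

lemma in_gen_tau:
  assumes "tau G g \<in> K"
  shows "in_gen (reps G) K (\<lambda>\<rho>. trace (\<rho> g))"
  using generate_ring.incl[OF assms] by (simp add: in_gen_def tau_def)

lemma reps_det:
  assumes "\<rho> \<in> reps G" "g \<in> carrier G"
  shows "det (\<rho> g) = 1"
  using assms by (auto simp: reps_def hom_def SL2C_def)

lemma reps_mult:
  assumes "\<rho> \<in> reps G" "g \<in> carrier G" "h \<in> carrier G"
  shows "\<rho> (g \<otimes>\<^bsub>G\<^esub> h) = \<rho> g ** \<rho> h"
  using assms by (auto simp: reps_def hom_def SL2C_def)

lemma word_class_in_carrier: "word_class R u \<in> carrier (presented_group R)"
  by (simp add: presented_group_carrier)

lemma reps_word_class:
  assumes "\<rho> \<in> reps (presented_group R)"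
  shows "\<rho> (word_class R u) = word_eval SL2C (\<lambda>a. \<rho> (word_class R [(a, True)])) u"
  using assms group.hom_word_class[OF group_SL2C] by (auto simp: reps_def)

lemma word_eval_SL2C_Cons:
  assumes "det (f a) = 1"
  shows "word_eval SL2C f ((a, b) # w) =
    (if b then f a else mat (trace (f a)) - f a) ** word_eval SL2C f w"
  using SL2C_inv[OF assms] by (simp add: SL2C_def)

lemma trace_comb:
  "trace (comb A B (a, b, c, d)) = a + a + b * trace A + c * trace B + d * trace (A ** B)"
  by (simp add: comb_def mat2_simps algebra_simps)

text \<open>Induction on the word, prepending one letter at a time. The coefficients are functions
  of the representation, so one choice of them serves all of \<open>reps G\<close>.\<close>

lemma word_eval_comb:
  fixes R :: "(gen word \<times> gen word) set"
  defines "G \<equiv> presented_group R" and "x \<equiv> word_class R [(Gx, True)]" and "y \<equiv> word_class R [(Gy, True)]"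
  defines "K \<equiv> {tau G x, tau G y, tau G (x \<otimes>\<^bsub>G\<^esub> y)}"
  obtains a b c d where "in_gen (reps G) K a" "in_gen (reps G) K b" "in_gen (reps G) K c" "in_gen (reps G) K d"
    "\<And>\<rho>. \<rho> \<in> reps G \<Longrightarrow> \<rho> (word_class R w) = comb (\<rho> x) (\<rho> y) (a \<rho>, b \<rho>, c \<rho>, d \<rho>)"
proof -
  let ?gen = "in_gen (reps G) K"
  define f where "f = (\<lambda>\<rho> a. \<rho> (word_class R [(a :: gen, True)]) :: complex^2^2)"
  have f: "f \<rho> Gx = \<rho> x" "f \<rho> Gy = \<rho> y" for \<rho> by (simp_all add: f_def x_def y_def)
  have xy: "x \<in> carrier G" "y \<in> carrier G" by (simp_all add: G_def x_def y_def word_class_in_carrier)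
  have det: "det (f \<rho> a) = 1" if "\<rho> \<in> reps G" for \<rho> a
    using reps_det[OF that] by (simp add: f_def G_def word_class_in_carrier)
  have gen: "?gen (\<lambda>\<rho>. trace (\<rho> x))" "?gen (\<lambda>\<rho>. trace (\<rho> y))" "?gen (\<lambda>\<rho>. trace (\<rho> (x \<otimes>\<^bsub>G\<^esub> y)))"
    by (auto intro!: in_gen_tau simp: K_def)
  \<comment> \<open>The invariant of the induction, stable under left multiplication by the
    generators and their inverses.\<close>
  define P where "P = (\<lambda>M. \<exists>a b c d. ?gen a \<and> ?gen b \<and> ?gen c \<and> ?gen d \<and>
    (\<forall>\<rho>\<in>reps G. M \<rho> = comb (\<rho> x) (\<rho> y) (a \<rho>, b \<rho>, c \<rho>, d \<rho>)))"
  have left: "P (\<lambda>\<rho>. f \<rho> g ** M \<rho>)" if M: "P M" for g M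
  proof -
    obtain a b c d where abcd: "?gen a" "?gen b" "?gen c" "?gen d"
      "\<And>\<rho>. \<rho> \<in> reps G \<Longrightarrow> M \<rho> = comb (\<rho> x) (\<rho> y) (a \<rho>, b \<rho>, c \<rho>, d \<rho>)"
      using M unfolding P_def by blast
    show ?thesis
    proof (cases g)
      case Gx
      show ?thesis unfolding P_def Gx f
        by (rule exI[of _ "\<lambda>\<rho>. - b \<rho>"], rule exI[of _ "\<lambda>\<rho>. a \<rho> + trace (\<rho> x) * b \<rho>"],
            rule exI[of _ "\<lambda>\<rho>. - d \<rho>"], rule exI[of _ "\<lambda>\<rho>. c \<rho> + trace (\<rho> x) * d \<rho>"])
          (use abcd gen det[of _ Gx] in \<open>auto intro!: in_gen_intros simp: f comb_left1\<close>)
    next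
      case Gy
      show ?thesis unfolding P_def Gy f
        by (rule exI[of _ "\<lambda>\<rho>. b \<rho> * (trace (\<rho> (x \<otimes>\<^bsub>G\<^esub> y)) - trace (\<rho> x) * trace (\<rho> y)) - c \<rho> - d \<rho> * trace (\<rho> x)"],
            rule exI[of _ "\<lambda>\<rho>. b \<rho> * trace (\<rho> y) + d \<rho>"],
            rule exI[of _ "\<lambda>\<rho>. a \<rho> + b \<rho> * trace (\<rho> x) + c \<rho> * trace (\<rho> y) + d \<rho> * trace (\<rho> (x \<otimes>\<^bsub>G\<^esub> y))"],
            rule exI[of _ "\<lambda>\<rho>. - b \<rho>"])
          (use abcd gen det[of _ Gx] det[of _ Gy] xy in
            \<open>auto intro!: in_gen_intros simp: f comb_left2 reps_mult\<close>)
    qed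
  qed
  have left_inv: "P (\<lambda>\<rho>. (mat (trace (f \<rho> g)) - f \<rho> g) ** M \<rho>)" if M: "P M" for g M
  proof -
    obtain a b c d where abcd: "?gen a" "?gen b" "?gen c" "?gen d"
      "\<And>\<rho>. \<rho> \<in> reps G \<Longrightarrow> M \<rho> = comb (\<rho> x) (\<rho> y) (a \<rho>, b \<rho>, c \<rho>, d \<rho>)"
      using M unfolding P_def by blast
    obtain a' b' c' d' where abcd': "?gen a'" "?gen b'" "?gen c'" "?gen d'"
      "\<And>\<rho>. \<rho> \<in> reps G \<Longrightarrow> f \<rho> g ** M \<rho> = comb (\<rho> x) (\<rho> y) (a' \<rho>, b' \<rho>, c' \<rho>, d' \<rho>)"
      using left[OF M, of g] unfolding P_def by blast
    have t: "?gen (\<lambda>\<rho>. trace (f \<rho> g))" using gen by (cases g) (simp_all add: f)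
    show ?thesis unfolding P_def
      by (rule exI[of _ "\<lambda>\<rho>. trace (f \<rho> g) * a \<rho> - a' \<rho>"], rule exI[of _ "\<lambda>\<rho>. trace (f \<rho> g) * b \<rho> - b' \<rho>"],
          rule exI[of _ "\<lambda>\<rho>. trace (f \<rho> g) * c \<rho> - c' \<rho>"], rule exI[of _ "\<lambda>\<rho>. trace (f \<rho> g) * d \<rho> - d' \<rho>"])
        (use abcd(1-4) abcd'(1-4) t in \<open>auto intro!: in_gen_intros comb_scale_diff[OF abcd(5) abcd'(5)]\<close>)
  qed
  have "P (\<lambda>\<rho>. word_eval SL2C (f \<rho>) w)"
  proof (induction w)
    case Nil
    show ?case unfolding P_def
      by (rule exI[of _ "\<lambda>_. 1"], rule exI[of _ "\<lambda>_. 0"], rule exI[of _ "\<lambda>_. 0"], rule exI[of _ "\<lambda>_. 0"])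
        (auto intro!: in_gen_intros simp: SL2C_def comb_def mat2_simps)
  next
    case (Cons l w)
    obtain g b where l: "l = (g, b)" by force
    have "P (\<lambda>\<rho>. (if b then f \<rho> g else mat (trace (f \<rho> g)) - f \<rho> g) ** word_eval SL2C (f \<rho>) w)"
      using left[OF Cons, of g] left_inv[OF Cons, of g] by (cases b) auto
    then show ?case
      unfolding P_def l using det by (simp add: word_eval_SL2C_Cons del: word_eval.simps)
  qed
  then obtain a b c d where "?gen a" "?gen b" "?gen c" "?gen d"
    "\<And>\<rho>. \<rho> \<in> reps G \<Longrightarrow> word_eval SL2C (f \<rho>) w = comb (\<rho> x) (\<rho> y) (a \<rho>, b \<rho>, c \<rho>, d \<rho>)"
    unfolding P_def by blast
  moreover have "\<rho> (word_class R w) = word_eval SL2C (f \<rho>) w" if "\<rho> \<in> reps G" for \<rho>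
    using that unfolding G_def f_def by (rule reps_word_class)
  ultimately show ?thesis by (intro that[of a b c d]) simp_all
qed

text \<open>By \<open>word_eval_comb\<close> and linearity every trace function is a combination of
  2, tr(A), tr(B), tr(A B) with coefficients in the ring generated by these three traces.\<close>

lemma trace_generators_presented_group:
  fixes R :: "(gen word \<times> gen word) set"
  defines "G \<equiv> presented_group R" and "x \<equiv> word_class R [(Gx, True)]" and "y \<equiv> word_class R [(Gy, True)]"
  shows "trace_generators G [x, y, x \<otimes>\<^bsub>G\<^esub> y]"
proof -
  interpret group G unfolding G_def by (rule group_presented_group)
  interpret F: cring "function_ring (reps G)" by (rule cring_function_ring)
  let ?K = "{tau G x, tau G y, tau G (x \<otimes>\<^bsub>G\<^esub> y)}"
  have xy: "x \<in> carrier G" "y \<in> carrier G" by (simp_all add: G_def x_def y_def word_class_in_carrier)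
  have ext: "tau G ` A \<subseteq> carrier (function_ring (reps G))" for A
    by (auto simp: function_ring_def tau_extensional)
  have "tau G g \<in> generate_ring (function_ring (reps G)) ?K" if g: "g \<in> carrier G" for g
  proof -
    obtain w where w: "g = word_class R w" using g unfolding G_def presented_group_carrier by blast
    obtain a b c d where abcd: "in_gen (reps G) ?K a" "in_gen (reps G) ?K b" "in_gen (reps G) ?K c"
      "in_gen (reps G) ?K d" "\<And>\<rho>. \<rho> \<in> reps G \<Longrightarrow> \<rho> g = comb (\<rho> x) (\<rho> y) (a \<rho>, b \<rho>, c \<rho>, d \<rho>)"
      unfolding w G_def x_def y_def by (rule word_eval_comb[of R w]) blast
    let ?t = "\<lambda>\<rho>. a \<rho> + a \<rho> + b \<rho> * trace (\<rho> x) + c \<rho> * trace (\<rho> y) + d \<rho> * trace (\<rho> (x \<otimes>\<^bsub>G\<^esub> y))"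
    have "in_gen (reps G) ?K ?t" using abcd(1-4) by (intro in_gen_intros in_gen_tau) auto
    moreover have "tau G g = restrict ?t (reps G)"
      unfolding tau_def
    proof (rule restrict_ext)
      show "trace (\<rho> g) = ?t \<rho>" if "\<rho> \<in> reps G" for \<rho>
        unfolding abcd(5)[OF that] trace_comb reps_mult[OF that xy] ..
    qed
    ultimately show ?thesis by (simp add: in_gen_def)
  qed
  then have "tau G ` carrier G \<subseteq> generate_ring (function_ring (reps G)) ?K" by blast
  then have "generate_ring (function_ring (reps G)) (tau G ` carrier G)
      \<subseteq> generate_ring (function_ring (reps G)) ?K"
    using ext[of "carrier G"] xy
    by (intro F.generate_ring_min_subring1 F.generate_ring_is_subring)
      (auto simp: function_ring_def tau_extensional)
  moreover have "generate_ring (function_ring (reps G)) ?K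
      \<subseteq> generate_ring (function_ring (reps G)) (tau G ` carrier G)"
    using xy by (intro F.mono_generate_ring ext) auto
  moreover have "tau G ` set [x, y, x \<otimes>\<^bsub>G\<^esub> y] = ?K" by simp
  ultimately show ?thesis
    using xy unfolding trace_generators_def by simp
qed

section \<open>Polynomial functions and change of coordinates\<close>

lemma polynomial_fun_uminus: "polynomial_fun n f \<Longrightarrow> polynomial_fun n (\<lambda>v. - f v)"
  using polynomial_fun.mult[OF polynomial_fun.const[of n "-1"]] by force

lemma polynomial_fun_diff:
  "polynomial_fun n f \<Longrightarrow> polynomial_fun n g \<Longrightarrow> polynomial_fun n (\<lambda>v. f v - g v)"
  using polynomial_fun.add[OF _ polynomial_fun_uminus] by force

lemma polynomial_fun_power: "polynomial_fun n f \<Longrightarrow> polynomial_fun n (\<lambda>v. f v ^ k)"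
  by (induction k) (auto intro: polynomial_fun.intros)

lemma polynomial_fun_prod:
  "(\<And>i. i \<in> I \<Longrightarrow> polynomial_fun n (f i)) \<Longrightarrow> polynomial_fun n (\<lambda>v. \<Prod>i\<in>I. f i v)"
  by (induction I rule: infinite_finite_induct) (auto intro: polynomial_fun.intros)

lemma polynomial_fun_poly: "polynomial_fun n f \<Longrightarrow> polynomial_fun n (\<lambda>v. poly p (f v))"
  by (induction p) (auto intro: polynomial_fun.intros)

lemma polynomial_fun_compose:
  assumes "polynomial_fun (length fs) g" "\<And>f. f \<in> set fs \<Longrightarrow> polynomial_fun n f"
  shows "polynomial_fun n (\<lambda>v. g (map (\<lambda>f. f v) fs))"
  using assms(1) by induction (auto intro: polynomial_fun.intros assms(2))

text \<open>Each step in generating the ring is matched by the same operation on polynomials in the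
  coordinates.\<close>

lemma generate_ring_tau_polynomial:
  assumes "h \<in> generate_ring (function_ring (reps G)) (tau G ` set \<gamma>s)"
  shows "\<exists>f. polynomial_fun (length \<gamma>s) f \<and> (\<forall>\<rho>\<in>reps G. h \<rho> = f (trace_point G \<gamma>s \<rho>))"
proof -
  interpret cring "function_ring (reps G)" by (rule cring_function_ring)
  \<comment> \<open>Required by \<open>a_inv_function_ring\<close>, which computes ring negatives
    pointwise for extensional functions.\<close>
  have ext: "g \<in> extensional (reps G)"
    if "g \<in> generate_ring (function_ring (reps G)) (tau G ` set \<gamma>s)" for g
  proof -
    have "tau G ` set \<gamma>s \<subseteq> carrier (function_ring (reps G))"
      by (auto simp: function_ring_def tau_extensional)
    from generate_ring_in_carrier[OF this that] show ?thesis by (simp add: function_ring_def)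
  qed
  show ?thesis using assms
  proof induction
    case one
    show ?case by (rule exI[of _ "\<lambda>_. 1"]) (auto intro: polynomial_fun.intros simp: function_ring_def)
  next
    case (incl h)
    then obtain i where i: "i < length \<gamma>s" "h = tau G (\<gamma>s ! i)" by (auto simp: in_set_conv_nth)
    then show ?case
      by (intro exI[of _ "\<lambda>v. v ! i"]) (auto intro: polynomial_fun.intros simp: trace_point_def)
  next
    case (a_inv h)
    then obtain f where "polynomial_fun (length \<gamma>s) f" "\<forall>\<rho>\<in>reps G. h \<rho> = f (trace_point G \<gamma>s \<rho>)" by blast
    then show ?case
      by (intro exI[of _ "\<lambda>v. - f v"]) (auto intro: polynomial_fun_uminus simp: a_inv_function_ring ext a_inv)
  next
    case (eng_add h1 h2)
    then obtain f1 f2 where "polynomial_fun (length \<gamma>s) f1" "\<forall>\<rho>\<in>reps G. h1 \<rho> = f1 (trace_point G \<gamma>s \<rho>)"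
      "polynomial_fun (length \<gamma>s) f2" "\<forall>\<rho>\<in>reps G. h2 \<rho> = f2 (trace_point G \<gamma>s \<rho>)" by blast
    then show ?case
      by (intro exI[of _ "\<lambda>v. f1 v + f2 v"]) (auto intro: polynomial_fun.intros simp: function_ring_def)
  next
    case (eng_mult h1 h2)
    then obtain f1 f2 where "polynomial_fun (length \<gamma>s) f1" "\<forall>\<rho>\<in>reps G. h1 \<rho> = f1 (trace_point G \<gamma>s \<rho>)"
      "polynomial_fun (length \<gamma>s) f2" "\<forall>\<rho>\<in>reps G. h2 \<rho> = f2 (trace_point G \<gamma>s \<rho>)" by blast
    then show ?case
      by (intro exI[of _ "\<lambda>v. f1 v * f2 v"]) (auto intro: polynomial_fun.intros simp: function_ring_def)
  qed
qed

text \<open>The trace functions of \<open>\<delta>s\<close> lie in the ring of all traces, which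
  those of \<open>\<gamma>s\<close> generate.\<close>

lemma trace_point_change:
  assumes "trace_generators G \<gamma>s" "trace_generators G \<delta>s"
  obtains fs where "length fs = length \<delta>s" "\<And>f. f \<in> set fs \<Longrightarrow> polynomial_fun (length \<gamma>s) f"
    "\<And>\<rho>. \<rho> \<in> reps G \<Longrightarrow> map (\<lambda>f. f (trace_point G \<gamma>s \<rho>)) fs = trace_point G \<delta>s \<rho>"
proof -
  have "\<exists>f. polynomial_fun (length \<gamma>s) f \<and> (\<forall>\<rho>\<in>reps G. tau G g \<rho> = f (trace_point G \<gamma>s \<rho>))"
    if "g \<in> set \<delta>s" for g
  proof (rule generate_ring_tau_polynomial)
    have "tau G g \<in> tau G ` carrier G" using that assms(2) by (auto simp: trace_generators_def)
    then show "tau G g \<in> generate_ring (function_ring (reps G)) (tau G ` set \<gamma>s)"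
      using assms(1) generate_ring.incl unfolding trace_generators_def by metis
  qed
  then obtain F where "\<And>g. g \<in> set \<delta>s \<Longrightarrow> polynomial_fun (length \<gamma>s) (F g)"
    "\<And>g \<rho>. g \<in> set \<delta>s \<Longrightarrow> \<rho> \<in> reps G \<Longrightarrow> tau G g \<rho> = F g (trace_point G \<gamma>s \<rho>)"
    by metis
  then show ?thesis
    by (intro that[of "map F \<delta>s"]) (auto simp: trace_point_def)
qed

text \<open>The polynomial coordinate changes in the two directions are mutually inverse on points
  of representations. Algebraicity is transported from one set to the other.\<close>

lemma affine_iso_character_varieties:
  assumes \<gamma>s: "trace_generators G \<gamma>s" and \<delta>s: "trace_generators G \<delta>s"
    and alg: "affine_algebraic_set (length \<delta>s) (character_variety G \<delta>s)"
  obtains \<phi> where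
    "affine_iso (length \<gamma>s) (character_variety G \<gamma>s) (length \<delta>s) (character_variety G \<delta>s) \<phi>"
    "\<And>\<rho>. \<rho> \<in> reps G \<Longrightarrow> \<phi> (trace_point G \<gamma>s \<rho>) = trace_point G \<delta>s \<rho>"
proof -
  let ?V = "character_variety G \<gamma>s" and ?W = "character_variety G \<delta>s"
  obtain fs where fs: "length fs = length \<delta>s" "\<And>f. f \<in> set fs \<Longrightarrow> polynomial_fun (length \<gamma>s) f"
    "\<And>\<rho>. \<rho> \<in> reps G \<Longrightarrow> map (\<lambda>f. f (trace_point G \<gamma>s \<rho>)) fs = trace_point G \<delta>s \<rho>"
    using trace_point_change[OF \<gamma>s \<delta>s] by blast
  obtain gs where gs: "length gs = length \<gamma>s" "\<And>f. f \<in> set gs \<Longrightarrow> polynomial_fun (length \<delta>s) f"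
    "\<And>\<rho>. \<rho> \<in> reps G \<Longrightarrow> map (\<lambda>f. f (trace_point G \<delta>s \<rho>)) gs = trace_point G \<gamma>s \<rho>"
    using trace_point_change[OF \<delta>s \<gamma>s] by blast
  define \<phi> where "\<phi> = (\<lambda>v. map (\<lambda>f. f v) fs)"
  define \<psi> where "\<psi> = (\<lambda>v. map (\<lambda>f. f v) gs)"
  have \<phi>: "\<phi> (trace_point G \<gamma>s \<rho>) = trace_point G \<delta>s \<rho>" if "\<rho> \<in> reps G" for \<rho>
    using fs(3) that by (simp add: \<phi>_def)
  have \<psi>: "\<psi> (trace_point G \<delta>s \<rho>) = trace_point G \<gamma>s \<rho>" if "\<rho> \<in> reps G" for \<rho>
    using gs(3) that by (simp add: \<psi>_def)
  obtain F where F: "finite F" "\<And>f. f \<in> F \<Longrightarrow> polynomial_fun (length \<delta>s) f"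
    "?W = {w. length w = length \<delta>s \<and> (\<forall>f\<in>F. f w = 0)}"
    using alg unfolding affine_algebraic_set_def by blast
  \<comment> \<open>The equations of the target pulled back along \<open>\<phi>\<close>, together
    with \<open>\<psi> (\<phi> v) = v\<close> read coordinate by coordinate.\<close>
  define F' where "F' = (\<lambda>f v. f (\<phi> v)) ` F \<union> (\<lambda>i v. (gs ! i) (\<phi> v) - v ! i) ` {..<length \<gamma>s}"
  have "affine_algebraic_set (length \<gamma>s) ?V"
    unfolding affine_algebraic_set_def
  proof (intro exI[of _ F'] conjI ballI)
    show "finite F'" using F(1) by (simp add: F'_def)
    show "polynomial_fun (length \<gamma>s) f" if "f \<in> F'" for f
      using that fs F(2) gs(1,2) unfolding F'_def \<phi>_def
      by (auto intro!: polynomial_fun_compose polynomial_fun_diff polynomial_fun.coord)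
    \<comment> \<open>If \<open>\<phi> v\<close> is the point of a representation in the target,
      then v = \<open>\<psi> (\<phi> v)\<close> is its point in the source.\<close>
    have "v \<in> ?V \<longleftrightarrow> length v = length \<gamma>s \<and> \<phi> v \<in> ?W \<and> \<psi> (\<phi> v) = v" for v
      using \<phi> \<psi> unfolding character_variety_def by (auto simp: trace_point_def)
    moreover have "\<phi> v \<in> ?W \<longleftrightarrow> (\<forall>f\<in>F. f (\<phi> v) = 0)" for v
      unfolding F(3) by (simp add: \<phi>_def fs(1))
    moreover have "\<psi> (\<phi> v) = v \<longleftrightarrow> (\<forall>i<length \<gamma>s. (gs ! i) (\<phi> v) - v ! i = 0)" if "length v = length \<gamma>s" for v
      using that gs(1) unfolding \<psi>_def by (auto simp: list_eq_iff_nth_eq)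
    moreover have "(\<forall>f\<in>F'. f v = 0) \<longleftrightarrow>
        (\<forall>f\<in>F. f (\<phi> v) = 0) \<and> (\<forall>i<length \<gamma>s. (gs ! i) (\<phi> v) - v ! i = 0)" for v
      unfolding F'_def ball_Un ball_simps lessThan_iff by blast
    ultimately show "?V = {v. length v = length \<gamma>s \<and> (\<forall>f\<in>F'. f v = 0)}"
      by blast
  qed
  moreover have "regular_map (length \<gamma>s) ?V (length \<delta>s) ?W \<phi>"
    unfolding regular_map_def character_variety_def using fs(1,2) \<phi>
    by (auto intro!: exI[of _ fs]) (auto simp: \<phi>_def)
  moreover have "regular_map (length \<delta>s) ?W (length \<gamma>s) ?V \<psi>"
    unfolding regular_map_def character_variety_def using gs(1,2) \<psi>
    by (auto intro!: exI[of _ gs]) (auto simp: \<psi>_def)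
  ultimately have "affine_iso (length \<gamma>s) ?V (length \<delta>s) ?W \<phi>"
    unfolding affine_iso_def using alg \<phi> \<psi>
    by (intro conjI exI[of _ \<psi>]) (auto simp: character_variety_def)
  then show ?thesis using that \<phi> by blast
qed

section \<open>The character variety of \<open>H\<^sub>m\<close>\<close>

lemma alternating_snoc: "alternating a b (Suc (2 * k)) = alternating a b (2 * k) @ [(a, True)]"
  by (induction k) auto

lemma word_eval_SL2C_True: "word_eval SL2C f ((a, True) # w) = f a ** word_eval SL2C f w"
  by (simp add: SL2C_def)

lemma word_eval_SL2C_alternating:
  "word_eval SL2C f (alternating a b (Suc n)) = f a ** word_eval SL2C f (alternating b a n)"
  by (simp add: word_eval_SL2C_True del: word_eval.simps)

text \<open>With C = A B or B A this relates three consecutive alternating words of odd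
  length.\<close>

lemma mat2_Cayley_Hamilton:
  fixes C X :: "complex^2^2"
  assumes "det C = 1"
  shows "C ** (C ** X) = mat (trace C) ** (C ** X) - X"
proof -
  obtain p q r s where C: "C = vector [vector [p, q], vector [r, s]]" by (rule mat2_cases)
  obtain t u v w where X: "X = vector [vector [t, u], vector [v, w]]" by (rule mat2_cases)
  show ?thesis
    using assms unfolding C X by (simp add: mat2_simps) (intro conjI; Groebner_Basis.algebra)
qed

text \<open>With Z = tr(A B) one has A B A = Z A - tr(B) + B and B A B = Z B - tr(A) + A; the
  scalars cancel because the traces agree.\<close>

lemma mat2_braid_diff:
  fixes A B :: "complex^2^2"
  assumes "det A = 1" "det B = 1" "trace A = trace B"
  shows "A ** (B ** A) - B ** (A ** B) = mat (trace (A ** B) - 1) ** (A - B)"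
proof -
  obtain p q r s where A: "A = vector [vector [p, q], vector [r, s]]" by (rule mat2_cases)
  obtain t u v w where B: "B = vector [vector [t, u], vector [v, w]]" by (rule mat2_cases)
  show ?thesis
    using assms unfolding A B by (simp add: mat2_simps) (intro conjI; Groebner_Basis.algebra)
qed

text \<open>Both words satisfy the recursion of \<open>curve_seq\<close>, because A B and B A have
  the same trace; it remains to compare the cases k = 0 and k = 1.\<close>

lemma word_eval_alternating_diff:
  assumes det: "\<And>a. det (f a) = 1" and tr: "trace (f Gx) = trace (f Gy)"
  shows "word_eval SL2C f (alternating Gx Gy (Suc (2 * k))) - word_eval SL2C f (alternating Gy Gx (Suc (2 * k)))
    = mat (curve_seq (trace (f Gx ** f Gy)) k) ** (f Gx - f Gy)"
proof -
  define z where "z = trace (f Gx ** f Gy)"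
  define P where "P = (\<lambda>k. word_eval SL2C f (alternating Gx Gy (Suc (2 * k))))"
  define Q where "Q = (\<lambda>k. word_eval SL2C f (alternating Gy Gx (Suc (2 * k))))"
  have P0: "P 0 = f Gx" and Q0: "Q 0 = f Gy"
    by (simp_all add: P_def Q_def SL2C_def)
  have P: "P (Suc k) = (f Gx ** f Gy) ** P k" and Q: "Q (Suc k) = (f Gy ** f Gx) ** Q k" for k
    by (simp_all add: P_def Q_def word_eval_SL2C_True matrix_mul_assoc del: word_eval.simps)
  have "det (f Gx ** f Gy) = 1" "det (f Gy ** f Gx) = 1" by (simp_all add: det_mul det)
  moreover have "trace (f Gy ** f Gx) = z" unfolding z_def by (rule trace_mul_sym)
  ultimately have P2: "P (Suc (Suc k)) = mat z ** P (Suc k) - P k"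
    and Q2: "Q (Suc (Suc k)) = mat z ** Q (Suc k) - Q k" for k
    unfolding P Q using mat2_Cayley_Hamilton z_def by metis+
  have "P k - Q k = mat (curve_seq z k) ** (f Gx - f Gy)"
  proof (induction k rule: induct_nat_012)
    case 0
    then show ?case by (simp add: P0 Q0)
  next
    case 1
    then show ?case
      using mat2_braid_diff[OF det det tr] by (simp add: P Q P0 Q0 matrix_mul_assoc z_def)
  next
    case (ge2 k)
    have "P (Suc (Suc k)) - Q (Suc (Suc k)) = mat z ** (P (Suc k) - Q (Suc k)) - (P k - Q k)"
      unfolding P2 Q2 by (simp add: mat2_simps algebra_simps)
    also have "\<dots> = mat (curve_seq z (Suc (Suc k))) ** (f Gx - f Gy)"
      unfolding ge2 by (simp add: mat2_simps algebra_simps)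
    finally show ?case .
  qed
  then show ?thesis by (simp add: P_def Q_def z_def del: alternating.simps word_eval.simps)
qed

lemma word_eval_alternating_eq_iff:
  assumes "\<And>a. det (f a) = 1" "trace (f Gx) = trace (f Gy)"
  shows "word_eval SL2C f (alternating Gx Gy (Suc (2 * k))) = word_eval SL2C f (alternating Gy Gx (Suc (2 * k)))
    \<longleftrightarrow> curve_seq (trace (f Gx ** f Gy)) k = 0 \<or> f Gx = f Gy"
proof -
  have "mat c ** M = 0 \<longleftrightarrow> c = 0 \<or> M = 0" for c :: complex and M :: "complex^2^2"
    by (auto simp: mat2_simps)
  then show ?thesis
    using word_eval_alternating_diff[of f k, OF assms] by (metis eq_iff_diff_eq_0)
qed

text \<open>With W = (A B)^k the two words are W A and B W, so their equality makes A and B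
  conjugate by W.\<close>

lemma trace_eq_of_alternating_eq:
  assumes det: "\<And>a. det (f a) = 1"
    and eq: "word_eval SL2C f (alternating Gx Gy (Suc (2 * k))) = word_eval SL2C f (alternating Gy Gx (Suc (2 * k)))"
  shows "trace (f Gx) = trace (f Gy)"
proof -
  interpret group SL2C by (rule group_SL2C)
  define W where "W = word_eval SL2C f (alternating Gx Gy (2 * k))"
  have f: "f a \<in> carrier SL2C" for a using det by (simp add: SL2C_def)
  have W: "W \<in> carrier SL2C" unfolding W_def by (rule word_eval_closed) (rule f)
  have "word_eval SL2C f (alternating Gx Gy (Suc (2 * k))) = W ** f Gx"
    unfolding alternating_snoc word_eval_append[of f, OF f] W_def by (simp add: SL2C_def)
  moreover have "word_eval SL2C f (alternating Gy Gx (Suc (2 * k))) = f Gy ** W"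
    unfolding word_eval_SL2C_alternating W_def ..
  ultimately have WW: "W ** f Gx = f Gy ** W" using eq by simp
  define V where "V = inv\<^bsub>SL2C\<^esub> W"
  have V: "V ** W = mat 1" "W ** V = mat 1"
    using W l_inv[OF W] r_inv[OF W] by (simp_all add: V_def SL2C_def)
  have "trace (f Gx) = trace (V ** (W ** f Gx))" by (simp add: matrix_mul_assoc V)
  also have "\<dots> = trace (f Gy ** (W ** V))"
    unfolding WW by (subst trace_mul_sym) (simp add: matrix_mul_assoc)
  finally show ?thesis by (simp add: V)
qed

section \<open>Points of the curve and representations of \<open>H m\<close>\<close>

lemma H_curve_alt:
  assumes "m = Suc (2 * k)"
  shows "H_curve m = {[X, Z] | X Z. X\<^sup>2 - Z - 2 = 0 \<or> curve_seq Z k = 0}"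
  using assms prod_star_q_poly_eq_0_iff[of m k] by (simp add: H_curve_def)

lemma affine_algebraic_H_curve: "affine_algebraic_set 2 (H_curve m)"
proof -
  let ?f = "\<lambda>v. ((v ! 0)\<^sup>2 - v ! 1 - 2) * (\<Prod>d\<in>{d. d dvd m \<and> d \<noteq> 1}. poly (star (q_poly d)) (v ! 1))"
  have "polynomial_fun 2 ?f"
    by (intro polynomial_fun.intros polynomial_fun_diff polynomial_fun_power polynomial_fun_prod
        polynomial_fun_poly) auto
  moreover have "H_curve m = {v. length v = 2 \<and> (\<forall>f\<in>{?f}. f v = 0)}"
    unfolding H_curve_def by (auto simp: numeral_2_eq_2 length_Suc_conv simp del: mult_eq_0_iff)
  ultimately show ?thesis
    unfolding affine_algebraic_set_def by blast
qed

text \<open>\<open>P Z\<close> stands for \<open>curve_seq Z k = 0\<close>. If it holds, a pair of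
  triangular matrices realises any X; otherwise Z = X^2 - 2, realised by A = B.\<close>

lemma SL2C_pair_exists:
  assumes "X\<^sup>2 - Z - 2 = 0 \<or> P Z"
  obtains A B :: "complex^2^2" where "det A = 1" "det B = 1" "trace A = X" "trace B = X"
    "trace (A ** B) = Z" "P Z \<or> A = B"
proof -
  obtain a where a: "a \<noteq> 0" "a + 1 / a = X" by (rule ex_add_inverse)
  show ?thesis
  proof (cases "P Z")
    case True
    let ?A = "vector [vector [a, 1], vector [0, 1 / a]] :: complex^2^2"
    \<comment> \<open>The lower left entry makes tr(A B) = a^2 + 1/a^2 + (Z - X^2 + 2) equal to Z,
      since a^2 + 1/a^2 = X^2 - 2.\<close>
    let ?B = "vector [vector [a, 0], vector [Z - X\<^sup>2 + 2, 1 / a]] :: complex^2^2"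
    have "trace (?A ** ?B) = Z"
      using a(1) unfolding a(2)[symmetric] by (simp add: mat2_simps field_simps power2_eq_square)
    then show ?thesis
      using that[of ?A ?B] a True by (simp add: mat2_simps)
  next
    case False
    let ?A = "vector [vector [a, 0], vector [0, 1 / a]] :: complex^2^2"
    have "Z = X\<^sup>2 - 2" using assms False by (simp add: algebra_simps)
    then have "trace (?A ** ?A) = Z"
      using a(1) unfolding a(2)[symmetric] by (simp add: mat2_simps field_simps power2_eq_square)
    then show ?thesis
      using that[of ?A ?A] a by (simp add: mat2_simps)
  qed
qed

text \<open>The trace of A^2 = tr(A) A - 1; it places the representations with A = B on the
  component Z = X^2 - 2.\<close>

lemma trace_square_SL2C:
  fixes A :: "complex^2^2"
  assumes "det A = 1"
  shows "(trace A)\<^sup>2 - trace (A ** A) - 2 = 0"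
  using assms by (simp add: mat2_simps power2_eq_square algebra_simps)

lemma H_xy_carrier: "H_x m \<in> carrier (H m)" "H_y m \<in> carrier (H m)"
  by (simp_all add: H_def H_x_def H_y_def word_class_in_carrier)

text \<open>The defining relation first forces equal traces; this makes
  \<open>word_eval_alternating_eq_iff\<close> applicable.\<close>

lemma reps_H:
  assumes m: "m = Suc (2 * k)" and \<rho>: "\<rho> \<in> reps (H m)"
  shows "trace (\<rho> (H_x m)) = trace (\<rho> (H_y m))"
    and "curve_seq (trace (\<rho> (H_x m) ** \<rho> (H_y m))) k = 0 \<or> \<rho> (H_x m) = \<rho> (H_y m)"
proof -
  define f where "f = (\<lambda>a. \<rho> (word_class (H_rel m) [(a, True)]))"
  have f: "\<rho> (H_x m) = f Gx" "\<rho> (H_y m) = f Gy" by (simp_all add: f_def H_x_def H_y_def)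
  have det: "det (f a) = 1" for a
    using reps_det[OF \<rho>] by (simp add: f_def H_def word_class_in_carrier)
  have ev: "\<rho> (word_class (H_rel m) u) = word_eval SL2C f u" for u
    using reps_word_class[of \<rho> "H_rel m" u] \<rho> by (simp add: H_def f_def)
  have "word_eq (H_rel m) (alternating Gx Gy m) (alternating Gy Gx m)"
    using word_eq.rel[of "alternating Gx Gy m" "alternating Gy Gx m" "H_rel m" "[]" "[]"]
    by (simp add: H_rel_def)
  then have "word_class (H_rel m) (alternating Gx Gy m) = word_class (H_rel m) (alternating Gy Gx m)"
    by (simp add: word_class_eq_iff)
  then have eq: "word_eval SL2C f (alternating Gx Gy m) = word_eval SL2C f (alternating Gy Gx m)"
    unfolding ev[symmetric] by (rule arg_cong)
  show tr: "trace (\<rho> (H_x m)) = trace (\<rho> (H_y m))"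
    unfolding f using trace_eq_of_alternating_eq[of f k, OF det] eq m by blast
  show "curve_seq (trace (\<rho> (H_x m) ** \<rho> (H_y m))) k = 0 \<or> \<rho> (H_x m) = \<rho> (H_y m)"
    using word_eval_alternating_eq_iff[of f k, OF det] tr eq m unfolding f by blast
qed

text \<open>For equal traces, \<open>rel\<close> is equivalent to the defining relation for A and B,
  so von Dyck's theorem applies.\<close>

lemma reps_H_exists:
  assumes m: "m = Suc (2 * k)" and det: "det A = 1" "det B = 1" and tr: "trace A = trace B"
    and rel: "curve_seq (trace (A ** B)) k = 0 \<or> A = B"
  obtains \<rho> where "\<rho> \<in> reps (H m)" "\<rho> (H_x m) = A" "\<rho> (H_y m) = B"
proof -
  interpret group SL2C by (rule group_SL2C)
  define f where "f = case_gen A B"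
  have detf: "det (f a) = 1" for a using det by (cases a) (simp_all add: f_def)
  then have f: "f a \<in> carrier SL2C" for a by (simp add: SL2C_def)
  have eq: "word_eval SL2C f (alternating Gx Gy m) = word_eval SL2C f (alternating Gy Gx m)"
    using word_eval_alternating_eq_iff[of f k, OF detf] tr rel m by (simp add: f_def)
  have R: "word_eval SL2C f r = word_eval SL2C f s" if "(r, s) \<in> H_rel m" for r s
    using that eq by (simp add: H_rel_def)
  obtain \<rho> where "\<rho> \<in> hom (presented_group (H_rel m)) SL2C"
    "\<rho> \<in> extensional (carrier (presented_group (H_rel m)))"
    "\<And>u. \<rho> (word_class (H_rel m) u) = word_eval SL2C f u"
    using presented_group_hom_exists[of f "H_rel m", OF f R] by blast
  then show ?thesis
    using that[of \<rho>] by (simp add: reps_def H_def H_x_def H_y_def) (simp add: SL2C_def f_def)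
qed

theorem corollary4p1:
  fixes m :: nat
  assumes "m > 1" and "odd m"
  shows "trace_generators (H m) [H_x m, H_y m, H_x m \<otimes>\<^bsub>H m\<^esub> H_y m] \<and>
    (\<forall>\<gamma>s. trace_generators (H m) \<gamma>s \<longrightarrow>
      (\<exists>\<phi>. affine_iso (length \<gamma>s) (character_variety (H m) \<gamma>s) 2 (H_curve m) \<phi> \<and>
        (\<forall>\<rho>\<in>reps (H m). \<phi> (trace_point (H m) \<gamma>s \<rho>) =
          [tau (H m) (H_x m) \<rho>, tau (H m) (H_x m \<otimes>\<^bsub>H m\<^esub> H_y m) \<rho>])))"
proof -
  obtain k where m: "m = Suc (2 * k)" using assms(2) by (auto elim: oddE)
  let ?x = "H_x m" and ?y = "H_y m" and ?xy = "H_x m \<otimes>\<^bsub>H m\<^esub> H_y m"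
  have gen: "trace_generators (H m) [?x, ?y, ?xy]"
    using trace_generators_presented_group[of "H_rel m"] by (simp add: H_def H_x_def H_y_def)
  \<comment> \<open>Dropping y therefore keeps the set of trace functions, and two coordinates
    suffice.\<close>
  have "tau (H m) ?x = tau (H m) ?y"
    unfolding tau_def using reps_H(1)[OF m] by (intro restrict_ext)
  then have gen2: "trace_generators (H m) [?x, ?xy]"
    using gen by (simp add: trace_generators_def)
  have xy: "\<rho> ?xy = \<rho> ?x ** \<rho> ?y" if "\<rho> \<in> reps (H m)" for \<rho>
    using reps_mult[OF that H_xy_carrier] .
  have variety: "character_variety (H m) [?x, ?xy] = H_curve m"
  proof (intro equalityI subsetI)
    fix v assume "v \<in> character_variety (H m) [?x, ?xy]"
    then obtain \<rho> where \<rho>: "\<rho> \<in> reps (H m)" and v: "v = trace_point (H m) [?x, ?xy] \<rho>"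
      by (auto simp: character_variety_def)
    have "v = [trace (\<rho> ?x), trace (\<rho> ?x ** \<rho> ?y)]"
      using \<rho> xy[OF \<rho>] by (simp add: v trace_point_def tau_eq)
    moreover have "det (\<rho> ?x) = 1" using reps_det[OF \<rho> H_xy_carrier(1)] .
    ultimately show "v \<in> H_curve m"
      unfolding H_curve_alt[OF m] using reps_H(2)[OF m \<rho>] trace_square_SL2C[of "\<rho> ?x"] by auto
  next
    fix v assume "v \<in> H_curve m"
    then obtain X Z where v: "v = [X, Z]" and XZ: "X\<^sup>2 - Z - 2 = 0 \<or> curve_seq Z k = 0"
      unfolding H_curve_alt[OF m] by blast
    obtain A B :: "complex^2^2" where AB: "det A = 1" "det B = 1" "trace A = X" "trace B = X"
      "trace (A ** B) = Z" "curve_seq Z k = 0 \<or> A = B"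
      using SL2C_pair_exists[of X Z "\<lambda>Z. curve_seq Z k = 0", OF XZ] by blast
    obtain \<rho> where \<rho>: "\<rho> \<in> reps (H m)" "\<rho> ?x = A" "\<rho> ?y = B"
      using reps_H_exists[OF m AB(1,2)] AB by metis
    then have "v = trace_point (H m) [?x, ?xy] \<rho>"
      using AB xy[OF \<rho>(1)] by (simp add: v trace_point_def tau_eq)
    then show "v \<in> character_variety (H m) [?x, ?xy]"
      using \<rho>(1) by (auto simp: character_variety_def)
  qed
  have "\<exists>\<phi>. affine_iso (length \<gamma>s) (character_variety (H m) \<gamma>s) 2 (H_curve m) \<phi> \<and>
        (\<forall>\<rho>\<in>reps (H m). \<phi> (trace_point (H m) \<gamma>s \<rho>) = [tau (H m) ?x \<rho>, tau (H m) ?xy \<rho>])"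
    if "trace_generators (H m) \<gamma>s" for \<gamma>s
  proof -
    have "affine_algebraic_set (length [?x, ?xy]) (character_variety (H m) [?x, ?xy])"
      using affine_algebraic_H_curve[of m] by (simp add: variety numeral_2_eq_2)
    from affine_iso_character_varieties[OF that gen2 this] obtain \<phi> where
      "affine_iso (length \<gamma>s) (character_variety (H m) \<gamma>s) (length [?x, ?xy]) (H_curve m) \<phi>"
      "\<And>\<rho>. \<rho> \<in> reps (H m) \<Longrightarrow> \<phi> (trace_point (H m) \<gamma>s \<rho>) = trace_point (H m) [?x, ?xy] \<rho>"
      unfolding variety by blast
    then show ?thesis by (intro exI[of _ \<phi>]) (auto simp: trace_point_def numeral_2_eq_2)
  qed
  then show ?thesis using gen by blast
qed

end
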